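(* Let $G$ be a connected, subcubic, triangle-free graph such that $G$ is not (isomorphic to) the cube graph $Q_3$. Then $G$ is partially DP-nice.
   Context: All graphs are nonempty, finite and simple. For $m\in\mathbb{N}=\{1,2,\dots\}$ write $[m]=\{1,\dots,m\}$. For $S,U\subseteq V(H)$, $E_H(S,U)$ is the set of edges of $H$ with at least one endpoint in $S$ and at least one endpoint in $U$. A cover of a graph $G$ is a pair $\mathcal{H}=(L,H)$ where $H$ is a graph and $L:V(G)\to\mathcal{P}(V(H))$ satisfies: (1) the sets $L(u)$, $u\in V(G)$, partition $V(H)$; (2) $H[L(u)]$ is complete for every $u\in V(G)$; (3) for every $uv\in E(G)$, $E_H(L(u),L(v))$ is a (possibly empty) matching; (4) if $u\neq v$ and $uv\notin E(G)$, then $E_H(L(u),L(v))=\emptyset$. The cover is $m$-fold if $|L(u)|=m$ for all $u\in V(G)$. An $\mathcal{H}$-coloring of $G$ is an independent set of size $|V(G)|$ in $H$. The DP-chromatic number $\chi_{DP}(G)$ is the smallest $m$ such that $G$ has an $\mathcal{H}$-coloring for every $m$-fold cover $\mathcal{H}$ of $G$. For $t\in\mathbb{N}$, the partial DP $t$-chromatic number $\alpha_t^{DP}(G)$ is the minimum of $\alpha(H)$ (the independence number of $H$) over all $t$-fold covers $\mathcal{H}=(L,H)$ of $G$. A graph $G$ is partially DP-nice if $\alpha_t^{DP}(G)\ge t|V(G)|/\chi_{DP}(G)$ for all $t\in[\chi_{DP}(G)]$. A graph is subcubic if its maximum degree is at most 3. The cube graph $Q_3$ has as vertices all bit strings of length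 three, two being adjacent if and only if they differ in exactly one bit. *)

theory Defs
  imports Complex_Main "Graph_Theory.Digraph_Isomorphism"
begin

text \<open>Undirected graphs are symmetric loop-free pair digraphs: every edge \<open>{x, y}\<close> is
  represented by the two arcs \<open>(x, y)\<close> and \<open>(y, x)\<close>.\<close>

definition simple_graph :: "'a pair_pre_digraph \<Rightarrow> bool" where
  "simple_graph G \<longleftrightarrow> pair_graph G \<and> pverts G \<noteq> {}"

definition uedges :: "'a pair_pre_digraph \<Rightarrow> 'a set set" where
  "uedges G = {{x, y} | x y. (x, y) \<in> parcs G}"

definition edges_between :: "'a pair_pre_digraph \<Rightarrow> 'a set \<Rightarrow> 'a set \<Rightarrow> 'a set set" where
  "edges_between G S U = {e \<in> uedges G. e \<inter> S \<noteq> {} \<and> e \<inter> U \<noteq> {}}"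

definition is_matching :: "'a set set \<Rightarrow> bool" where
  "is_matching M \<longleftrightarrow> (\<forall>e\<in>M. \<forall>f\<in>M. e \<noteq> f \<longrightarrow> e \<inter> f = {})"

definition indep_set :: "'a pair_pre_digraph \<Rightarrow> 'a set \<Rightarrow> bool" where
  "indep_set G I \<longleftrightarrow> I \<subseteq> pverts G \<and> (\<forall>x\<in>I. \<forall>y\<in>I. (x, y) \<notin> parcs G)"

definition indep_num :: "'a pair_pre_digraph \<Rightarrow> nat" where
  "indep_num G = Max {card I | I. indep_set G I}"

text \<open>Each arc represents one direction of an edge, so the out-degree is the degree.\<close>

definition max_degree :: "'a pair_pre_digraph \<Rightarrow> nat" where
  "max_degree G = Max (out_degree (with_proj G) ` pverts G)"

definition subcubic :: "'a pair_pre_digraph \<Rightarrow> bool" where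
  "subcubic G \<longleftrightarrow> max_degree G \<le> 3"

definition triangle_free :: "'a pair_pre_digraph \<Rightarrow> bool" where
  "triangle_free G \<longleftrightarrow>
    \<not> (\<exists>x y z. (x, y) \<in> parcs G \<and> (y, z) \<in> parcs G \<and> (z, x) \<in> parcs G)"

definition cube_graph :: "bool list pair_pre_digraph" where
  "cube_graph =
    \<lparr> pverts = {s. length s = 3},
      parcs = {(s, s'). length s = 3 \<and> length s' = 3 \<and> card {i. i < 3 \<and> s ! i \<noteq> s' ! i} = 1} \<rparr>"

definition dp_cover :: "'a pair_pre_digraph \<Rightarrow> ('a \<Rightarrow> 'b set) \<Rightarrow> 'b pair_pre_digraph \<Rightarrow> bool" where
  "dp_cover G L H \<longleftrightarrow>
     simple_graph H \<and>
     (\<Union>u\<in>pverts G. L u) = pverts H \<and> disjoint_family_on L (pverts G) \<and>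
     (\<forall>u\<in>pverts G. \<forall>x\<in>L u. \<forall>y\<in>L u. x \<noteq> y \<longrightarrow> (x, y) \<in> parcs H) \<and>
     (\<forall>u v. (u, v) \<in> parcs G \<longrightarrow> is_matching (edges_between H (L u) (L v))) \<and>
     (\<forall>u\<in>pverts G. \<forall>v\<in>pverts G. u \<noteq> v \<and> (u, v) \<notin> parcs G \<longrightarrow> edges_between H (L u) (L v) = {})"

text \<open>Empty parts are harmless above: covers are only used through the following notion with
  \<open>m \<ge> 1\<close>, where every part is nonempty.\<close>

definition fold_cover ::
  "nat \<Rightarrow> 'a pair_pre_digraph \<Rightarrow> ('a \<Rightarrow> 'b set) \<Rightarrow> 'b pair_pre_digraph \<Rightarrow> bool" where
  "fold_cover m G L H \<longleftrightarrow> dp_cover G L H \<and> (\<forall>u\<in>pverts G. card (L u) = m)"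

definition cover_coloring :: "'a pair_pre_digraph \<Rightarrow> 'b pair_pre_digraph \<Rightarrow> 'b set \<Rightarrow> bool" where
  "cover_coloring G H I \<longleftrightarrow> indep_set H I \<and> card I = card (pverts G)"

text \<open>Covers of \<open>G\<close> are quantified with vertices in \<^typ>\<open>nat\<close>. Every finite graph has an
  isomorphic copy on \<^typ>\<open>nat\<close>, so this is no restriction; see \<open>fold_cover_transfer_nat\<close>
  below.\<close>

definition dp_chromatic :: "'a pair_pre_digraph \<Rightarrow> nat" where
  "dp_chromatic G = (LEAST m. m \<ge> 1 \<and>
     (\<forall>(L :: 'a \<Rightarrow> nat set) H. fold_cover m G L H \<longrightarrow> (\<exists>I. cover_coloring G H I)))"

definition partial_dp :: "nat \<Rightarrow> 'a pair_pre_digraph \<Rightarrow> nat" where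
  "partial_dp t G =
     (LEAST k. \<exists>(L :: 'a \<Rightarrow> nat set) H. fold_cover t G L H \<and> k = indep_num H)"

definition partially_dp_nice :: "'a pair_pre_digraph \<Rightarrow> bool" where
  "partially_dp_nice G \<longleftrightarrow> (\<forall>t\<in>{1..dp_chromatic G}.
     real (partial_dp t G) \<ge> real t * real (card (pverts G)) / real (dp_chromatic G))"

lemma fold_cover_transfer_nat:
  fixes L :: "'a \<Rightarrow> 'b set"
  assumes cov: "fold_cover m G L H" and G: "simple_graph G"
  shows "\<exists>(L' :: 'a \<Rightarrow> nat set) H'. fold_cover m G L' H' \<and> indep_num H' = indep_num H \<and>
    ((\<exists>I. cover_coloring G H' I) \<longleftrightarrow> (\<exists>I. cover_coloring G H I))"
proof -
  have H: "pair_graph H" "pverts H \<noteq> {}"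
    using cov by (auto simp: fold_cover_def dp_cover_def simple_graph_def)
  interpret pair_graph H by fact
  have GV: "u \<in> pverts G" "v \<in> pverts G" if "(u, v) \<in> parcs G" for u v
  proof -
    interpret G: pair_graph G using G by (simp add: simple_graph_def)
    show "u \<in> pverts G" "v \<in> pverts G" using that G.in_arcsD1 G.in_arcsD2 by blast+
  qed
  obtain f :: "'b \<Rightarrow> nat" where f: "inj_on f (pverts H)"
    using pair_finite_verts finite_imp_inj_to_nat_seg by metis
  define H' where "H' = \<lparr>pverts = f ` pverts H, parcs = map_prod f f ` parcs H\<rparr>"
  define L' where "L' = (\<lambda>u. f ` L u)"
  have inV: "x \<in> pverts H \<and> y \<in> pverts H" if "(x, y) \<in> parcs H" for x y
    using that in_arcsD1 in_arcsD2 by blast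
  have arc: "(f x, f y) \<in> parcs H' \<longleftrightarrow> (x, y) \<in> parcs H"
    if "x \<in> pverts H" "y \<in> pverts H" for x y
  proof
    assume "(f x, f y) \<in> parcs H'"
    then obtain a b where ab: "(a, b) \<in> parcs H" "f x = f a" "f y = f b"
      by (auto simp: H'_def)
    hence "x = a" "y = b" using that inV f by (metis inj_onD)+
    thus "(x, y) \<in> parcs H" using ab by simp
  qed (force simp: H'_def)
  have LV: "L u \<subseteq> pverts H" if "u \<in> pverts G" for u
    using cov that by (auto simp: fold_cover_def dp_cover_def)
  have "pair_graph H'"
  proof
    show "symmetric (with_proj H')"
      using arcs_symmetric by (force simp: symmetric_def H'_def intro!: symI)
    show "\<And>e. e \<in> parcs H' \<Longrightarrow> fst e \<noteq> snd e"
      using inV no_loops' inj_onD[OF f] by (fastforce simp: H'_def)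
  qed (use inV pair_finite_verts pair_finite_arcs in \<open>auto simp: H'_def\<close>)
  hence sg: "simple_graph H'" using H by (simp add: simple_graph_def H'_def)
  have ue: "uedges H' = (`) f ` uedges H"
  proof (intro set_eqI iffI)
    fix e assume "e \<in> uedges H'"
    then obtain x y where "(x, y) \<in> parcs H" "e = f ` {x, y}"
      by (auto simp: uedges_def H'_def)
    thus "e \<in> (`) f ` uedges H" unfolding uedges_def by blast
  next
    fix e assume "e \<in> (`) f ` uedges H"
    then obtain x y where xy: "(x, y) \<in> parcs H" "e = {f x, f y}"
      by (auto simp: uedges_def)
    hence "(f x, f y) \<in> parcs H'" using inV arc by blast
    thus "e \<in> uedges H'" unfolding uedges_def using xy by blast
  qed
  have eV: "e \<subseteq> pverts H" if "e \<in> uedges H" for e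
    using that inV by (auto simp: uedges_def)
  have meet: "f ` A \<inter> f ` B = f ` (A \<inter> B)" if "A \<subseteq> pverts H" "B \<subseteq> pverts H" for A B
    using f that by (simp add: inj_on_image_Int)
  have eb: "edges_between H' (L' u) (L' v) = (`) f ` edges_between H (L u) (L v)"
    if "u \<in> pverts G" "v \<in> pverts G" for u v
  proof -
    have *: "(f ` e \<inter> f ` L w \<noteq> {}) = (e \<inter> L w \<noteq> {})"
      if "e \<in> uedges H" "w \<in> pverts G" for e w
      using meet[OF eV[OF that(1)] LV[OF that(2)]] by simp
    have "edges_between H' (L' u) (L' v) =
        (`) f ` {e \<in> uedges H. f ` e \<inter> f ` L u \<noteq> {} \<and> f ` e \<inter> f ` L v \<noteq> {}}"
      unfolding edges_between_def ue L'_def by (rule Compr_image_eq)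
    also have "{e \<in> uedges H. f ` e \<inter> f ` L u \<noteq> {} \<and> f ` e \<inter> f ` L v \<noteq> {}} =
        edges_between H (L u) (L v)"
      unfolding edges_between_def by (intro Collect_cong conj_cong refl *) (use that in auto)
    finally show ?thesis .
  qed
  have cL: "card (L' u) = card (L u)" if "u \<in> pverts G" for u
    unfolding L'_def using card_image inj_on_subset[OF f] LV[OF that] by blast
  have "dp_cover G L' H'"
    unfolding dp_cover_def
  proof (intro conjI ballI allI impI)
    show "simple_graph H'" by fact
    show "(\<Union>u\<in>pverts G. L' u) = pverts H'"
      using cov by (simp add: L'_def H'_def fold_cover_def dp_cover_def flip: image_UN)
    show "disjoint_family_on L' (pverts G)"
      using cov meet LV
      by (simp add: L'_def fold_cover_def dp_cover_def disjoint_family_on_def)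
    show "(x, y) \<in> parcs H'" if xy: "u \<in> pverts G" "x \<in> L' u" "y \<in> L' u" "x \<noteq> y" for u x y
    proof -
      obtain a b where ab: "a \<in> L u" "b \<in> L u" "x = f a" "y = f b" "a \<noteq> b"
        using xy by (auto simp: L'_def)
      hence "(a, b) \<in> parcs H"
        using cov xy(1) unfolding fold_cover_def dp_cover_def by blast
      thus ?thesis using ab arc LV[OF xy(1)] by blast
    qed
    show "is_matching (edges_between H' (L' u) (L' v))" if "(u, v) \<in> parcs G" for u v
    proof -
      have mat: "is_matching (edges_between H (L u) (L v))"
        using cov that by (simp add: fold_cover_def dp_cover_def)
      have sub1: "e \<subseteq> pverts H" if "e \<in> edges_between H (L u) (L v)" for e
        using that eV by (simp add: edges_between_def)
      have "f ` e \<inter> f ` e' = {}"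
        if "e \<in> edges_between H (L u) (L v)" "e' \<in> edges_between H (L u) (L v)" "f ` e \<noteq> f ` e'"
        for e e'
      proof -
        have "e \<inter> e' = {}"
          using that mat unfolding is_matching_def by blast
        thus ?thesis using meet[OF sub1[OF that(1)] sub1[OF that(2)]] by simp
      qed
      thus ?thesis
        unfolding eb[OF GV[OF that]] is_matching_def by simp
    qed
    show "edges_between H' (L' u) (L' v) = {}"
      if "u \<in> pverts G" "v \<in> pverts G" "u \<noteq> v \<and> (u, v) \<notin> parcs G" for u v
      using that cov eb by (simp add: fold_cover_def dp_cover_def)
  qed
  hence fc: "fold_cover m G L' H'" using cov cL by (simp add: fold_cover_def)
  have ind: "indep_set H' (f ` I) \<longleftrightarrow> indep_set H I" if "I \<subseteq> pverts H" for I
    using that arc by (auto simp: indep_set_def H'_def subset_iff)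
  have surj: "\<exists>I. I \<subseteq> pverts H \<and> J = f ` I" if "indep_set H' J" for J
    using that by (auto simp: indep_set_def H'_def subset_image_iff)
  have cI: "card (f ` I) = card I" if "I \<subseteq> pverts H" for I
    using card_image inj_on_subset[OF f that] by blast
  have sub: "I \<subseteq> pverts H" if "indep_set H I" for I using that by (simp add: indep_set_def)
  have sizes: "(\<exists>J. indep_set H' J \<and> card J = k) \<longleftrightarrow> (\<exists>I. indep_set H I \<and> card I = k)" for k
    using ind surj cI sub by metis
  have "{card J | J. indep_set H' J} = {card I | I. indep_set H I}"
    using sizes by (intro Collect_cong) (metis (no_types))
  hence "indep_num H' = indep_num H" by (simp add: indep_num_def)
  thus ?thesis using fc sizes unfolding cover_coloring_def by blast
qed

end

theory Submission
  imports Defs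
begin

text \<open>Greedy colouring gives \<open>\<chi> \<le> 4\<close> for the DP-chromatic number, so only \<open>t \<le> 4\<close> matters.
  The case \<open>t = \<chi>\<close> is trivial, for \<open>t = 1\<close> one colours \<open>\<chi>\<close> copies of the given cover, and if
  \<open>t = 3 < \<chi>\<close> a greedy argument loses at most one vertex in four. The heart is \<open>t = 2 < \<chi>\<close>. A
  two-fold cover is a signing of the edges, and a partial transversal of it is a vertex set that
  induces a balanced signed graph, so one has to make every signing balanced by deleting at most a
  third of the vertices.

  Take a minimal counterexample to this deletion bound among the triangle-free subcubic graphs that
  contain no cube. Signs can be transported along a bridge, a path with interior vertices of degree
  two can be replaced by an edge carrying its total sign, and a graph in which some vertex near
  the new edges has degree two has no new cube. Hence the counterexample has no bridge, is cubic,
  contains no \<open>K\<^bsub>2,3\<^esub>\<close>, and contains a four-cycle (else delete a vertex and suppress two of its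
  neighbours). The outer neighbours of a four-cycle are then matched either crosswise, as in
  the Wagner graph, or in parallel; the latter propagates to a ladder with five rungs, since
  closing up earlier gives a cube. Both configurations are reducible.\<close>

subsection \<open>Balancing signed graphs by deleting vertices\<close>

text \<open>The fraction one third is dictated by \<open>t = 2\<close> and
  \<open>\<chi> = 3\<close>, where two thirds of the parts must be met. The bound fails for the
  cube: sign its edges so that all six faces are unbalanced. Two vertices meet all faces only if
  they are antipodal, and the hexagon that they leave is the sum of three faces, hence unbalanced;
  so three deletions are needed, while \<open>8 div 3 = 2\<close>. Deletions destroy connectedness,
  so the induction excludes the cube as a subgraph and allows disconnected graphs. Since the bound
  speaks of all signings, a reduced graph may carry any signs; a reduction is paid for when it
  removes three vertices per deletion. The obstacle is that an added edge may close a triangle or a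
  cube. A triangle means that the ends had a common neighbour, which is either excluded beforehand
  or recorded as structure for the next reduction. A cube in a subcubic graph has all its degrees
  saturated and is closed under adjacency; hence a nearby vertex of degree two, or a bridge obtained
  by undoing the suppressions, is enough to rule it out.\<close>

type_synonym 'a binrel = "'a \<Rightarrow> 'a \<Rightarrow> bool"

text \<open>Harary's switching form of balance: for symmetric \<open>E\<close> and \<open>s\<close>,
  such a \<open>c\<close> exists iff every cycle in \<open>W\<close> has an even number of edges
  with \<open>s\<close>. Signs are added modulo two, so sums along paths appear below as chains of
  \<open>\<noteq>\<close>.\<close>

definition balanced_by :: "'a binrel \<Rightarrow> 'a binrel \<Rightarrow> 'a set \<Rightarrow> ('a \<Rightarrow> bool) \<Rightarrow> bool" where
  "balanced_by E s W c \<longleftrightarrow> (\<forall>u\<in>W. \<forall>v\<in>W. E u v \<longrightarrow> (c u \<noteq> c v) = s u v)"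

text \<open>Colours of adjacent vertices differ exactly on the edges with \<open>s u v\<close>; \<open>V\<close> is \<open>k\<close> deletions
  away from admitting such a colouring.\<close>

definition frust_le :: "nat \<Rightarrow> 'a binrel \<Rightarrow> 'a binrel \<Rightarrow> 'a set \<Rightarrow> bool" where
  "frust_le k E s V \<longleftrightarrow> (\<exists>D c. D \<subseteq> V \<and> card D \<le> k \<and> balanced_by E s (V - D) c)"

definition add_edge :: "'a \<Rightarrow> 'a \<Rightarrow> 'a binrel \<Rightarrow> 'a binrel" where
  "add_edge y z E = (\<lambda>u v. E u v \<or> u = y \<and> v = z \<or> u = z \<and> v = y)"

definition set_sign :: "'a \<Rightarrow> 'a \<Rightarrow> bool \<Rightarrow> 'a binrel \<Rightarrow> 'a binrel" where
  "set_sign y z b s = (\<lambda>u v. if u = y \<and> v = z \<or> u = z \<and> v = y then b else s u v)"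

text \<open>Everything is relative to \<open>V\<close>, so that deleting vertices shrinks
  \<open>V\<close> and leaves \<open>E\<close> and the signs alone. The case
  \<open>x = y = z\<close> of the last clause excludes loops.\<close>

definition tf_subcubic :: "'a binrel \<Rightarrow> 'a set \<Rightarrow> bool" where
  "tf_subcubic E V \<longleftrightarrow> finite V \<and> symp E \<and> (\<forall>u\<in>V. card {v\<in>V. E u v} \<le> 3) \<and>
     (\<forall>x\<in>V. \<forall>y\<in>V. \<forall>z\<in>V. E x y \<longrightarrow> E y z \<longrightarrow> \<not> E z x)"

text \<open>Two four-cycles joined by a matching. Further edges inside \<open>K\<close> need no
  exclusion, because the degree bound leaves no room for them.\<close>

definition cube_on :: "'a binrel \<Rightarrow> 'a set \<Rightarrow> bool" where
  "cube_on E K \<longleftrightarrow> (\<exists>a1 a2 a3 a4 b1 b2 b3 b4.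
     distinct [a1, a2, a3, a4, b1, b2, b3, b4] \<and> K = {a1, a2, a3, a4, b1, b2, b3, b4} \<and>
     E a1 a2 \<and> E a2 a3 \<and> E a3 a4 \<and> E a4 a1 \<and>
     E b1 b2 \<and> E b2 b3 \<and> E b3 b4 \<and> E b4 b1 \<and>
     E a1 b1 \<and> E a2 b2 \<and> E a3 b3 \<and> E a4 b4)"

definition cube_free :: "'a binrel \<Rightarrow> 'a set \<Rightarrow> bool" where
  "cube_free E V \<longleftrightarrow> (\<forall>K\<subseteq>V. \<not> cube_on E K)"

section \<open>Lifting colourings back through vertex reductions\<close>

lemma frust_le_mono:
  assumes "frust_le k E' s' V"
    and "\<And>u v. u \<in> V \<Longrightarrow> v \<in> V \<Longrightarrow> E u v \<Longrightarrow> E' u v \<and> s u v = s' u v"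
  shows "frust_le k E s V"
  using assms unfolding frust_le_def balanced_by_def by (metis DiffD1)

lemma frust_le_delete:
  assumes "frust_le k E s (V - {d})" "finite V" "d \<in> V"
  shows "frust_le (Suc k) E s V"
proof -
  obtain D c where D: "D \<subseteq> V - {d}" "card D \<le> k" "balanced_by E s (V - {d} - D) c"
    using assms(1) unfolding frust_le_def by blast
  have "finite D" using D(1) assms(2) finite_subset by blast
  hence "card (insert d D) \<le> Suc k" using D by (auto simp: card_insert_if)
  moreover have "V - insert d D = V - {d} - D" by auto
  ultimately show ?thesis unfolding frust_le_def using D assms(3)
    by (intro exI[of _ "insert d D"] exI[of _ c]) auto
qed

text \<open>A vertex in a balanced triangle with no further neighbours can always be coloured last.\<close>

lemma frust_le_drop:
  assumes k: "frust_le k E s (V - {x})" and "symp E" "symp s" "\<not> E x x" "x \<noteq> y" "x \<noteq> z"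
    and nb: "\<And>v. v \<in> V \<Longrightarrow> E x v \<Longrightarrow> v = y \<or> v = z"
    and yz: "E y z" "s y z = (s x y \<noteq> s x z)"
  shows "frust_le k E s V"
proof -
  obtain D c where D: "D \<subseteq> V - {x}" "card D \<le> k" "balanced_by E s (V - {x} - D) c"
    using k unfolding frust_le_def by blast
  define c' where "c' = c(x := if y \<in> V - D then c y \<noteq> s x y else c z \<noteq> s x z)"
  have x: "(c' x \<noteq> c v) = s x v" if "v \<in> V - D" "E x v" "v \<noteq> x" for v
  proof -
    have "v = y \<or> v = z" using nb that by blast
    moreover have "(c y \<noteq> c z) = s y z" if "y \<in> V - D" "z \<in> V - D"
      using D(3) that yz assms(5,6) unfolding balanced_by_def by blast
    ultimately show ?thesis using yz(2) that(1) by (auto simp: c'_def)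
  qed
  have "balanced_by E s (V - D) c'"
    unfolding balanced_by_def
  proof (intro ballI impI)
    fix u v assume uv: "u \<in> V - D" "v \<in> V - D" "E u v"
    show "(c' u \<noteq> c' v) = s u v"
    proof (cases "u = x \<or> v = x")
      case True
      have "s u v = s v u" "E v u" using assms(2,3) uv by (auto dest: sympD)
      thus ?thesis using True x[of u] x[of v] uv assms(4) by (cases "u = x"; cases "v = x") (auto simp: c'_def)
    next
      case False
      thus ?thesis using D(3) uv unfolding balanced_by_def c'_def by auto
    qed
  qed
  thus ?thesis unfolding frust_le_def using D by blast
qed

lemma symp_add_edge: "symp E \<Longrightarrow> symp (add_edge y z E)"
  unfolding add_edge_def symp_def by blast

lemma symp_set_sign: "symp s \<Longrightarrow> symp (set_sign y z b s)"
  unfolding set_sign_def symp_def by auto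

text \<open>With this sign the new edge forms a balanced triangle with \<open>x\<close>, so
  \<open>x\<close> can be coloured last, and then the edge is discarded by monotonicity. Because of
  \<open>\<not> E y z\<close> the new sign overwrites no genuine one.\<close>

lemma frust_le_suppress:
  assumes "frust_le k (add_edge y z E) (set_sign y z (s x y \<noteq> s x z) s) (V - {x})"
    and "symp E" "symp s" "\<not> E x x" "x \<noteq> y" "x \<noteq> z" "\<not> E y z"
    and "\<And>v. v \<in> V \<Longrightarrow> E x v \<Longrightarrow> v = y \<or> v = z"
  shows "frust_le k E s V"
proof -
  have "\<not> E z y" using assms(2,7) by (auto dest: sympD)
  have "frust_le k (add_edge y z E) (set_sign y z (s x y \<noteq> s x z) s) V"
    by (rule frust_le_drop[OF assms(1), where y = y and z = z])
       (use assms in \<open>auto simp: add_edge_def set_sign_def intro!: symp_add_edge symp_set_sign,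
         auto simp: symp_def\<close>)
  thus ?thesis
    by (rule frust_le_mono) (use assms(7) \<open>\<not> E z y\<close> in \<open>auto simp: add_edge_def set_sign_def\<close>)
qed

lemma frust_le_peel:
  assumes k: "frust_le k E s (V - {x})" and "symp E" "symp s" "\<not> E x x"
    and nb: "\<And>v. v \<in> V \<Longrightarrow> E x v \<Longrightarrow> v = p"
  shows "frust_le k E s V"
proof -
  obtain D c where D: "D \<subseteq> V - {x}" "card D \<le> k" "balanced_by E s (V - {x} - D) c"
    using k unfolding frust_le_def by blast
  have "balanced_by E s (V - D) (c(x := (c p \<noteq> s x p)))"
    unfolding balanced_by_def
  proof (intro ballI impI)
    fix u v assume uv: "u \<in> V - D" "v \<in> V - D" "E u v"
    have "s u v = s v u" "E v u" using assms(2,3) uv by (auto dest: sympD)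
    thus "((c(x := (c p \<noteq> s x p))) u \<noteq> (c(x := (c p \<noteq> s x p))) v) = s u v"
      using uv D(3) nb[of u] nb[of v] assms(4) unfolding balanced_by_def by (cases "u = x"; cases "v = x") auto
  qed
  thus ?thesis unfolding frust_le_def using D by blast
qed

text \<open>Within \<open>V\<close>, the vertices \<open>xs\<close> have no neighbours but those next to them on the path
  \<open>y # xs @ [z]\<close>.\<close>

fun thread :: "'a binrel \<Rightarrow> 'a set \<Rightarrow> 'a \<Rightarrow> 'a list \<Rightarrow> 'a \<Rightarrow> bool" where
  "thread E V y [] z = True"
| "thread E V y (x # xs) z =
     ((\<forall>v\<in>V. E x v \<longrightarrow> v = y \<or> v = hd (xs @ [z])) \<and> thread E V x xs z)"

lemma thread_mono:
  assumes "thread E V y xs z" "V' \<subseteq> V"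
    "\<And>u v. u \<in> set xs \<Longrightarrow> v \<in> V' \<Longrightarrow> E' u v \<Longrightarrow> E u v"
  shows "thread E' V' y xs z"
  using assms by (induction xs arbitrary: y) (auto simp: subset_iff)

text \<open>The sign \<open>t\<close> of the new edge is the sum of the signs along the suppressed path.\<close>

lemma frust_le_path:
  assumes "symp E" "symp s" "distinct (y # xs @ [z])" "xs \<noteq> []" "y \<in> V" "z \<in> V"
    and "set xs \<subseteq> V" "\<And>x. x \<in> set xs \<Longrightarrow> \<not> E x x" "\<not> E y z" "thread E V y xs z"
  shows "\<exists>t. symp t \<and> (\<forall>k. frust_le k (add_edge y z E) t (V - set xs) \<longrightarrow> frust_le k E s V)"
  using assms
proof (induction xs arbitrary: E s V)
  case (Cons x xs)
  show ?case
  proof (cases xs)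
    case Nil
    show ?thesis
      using Cons.prems Nil
      by (intro exI[of _ "set_sign y z (s x y \<noteq> s x z) s"])
         (auto intro!: symp_set_sign intro: frust_le_suppress[where x = x and y = y and z = z])
  next
    case (Cons x2 ys)
    \<comment> \<open>Suppressing the head \<open>x\<close> leaves a shorter path from
      \<open>y\<close> whose first interior vertex is \<open>x2\<close>.\<close>
    let ?E = "add_edge y x2 E" and ?s = "set_sign y x2 (s x y \<noteq> s x x2) s"
    have thr: "\<forall>v\<in>V. E x v \<longrightarrow> v = y \<or> v = x2" "\<forall>v\<in>V. E x2 v \<longrightarrow> v = x \<or> v = hd (ys @ [z])"
      "thread E V x2 ys z"
      using Cons.prems(10) Cons by auto
    have "hd (ys @ [z]) \<in> set (ys @ [z])" by (cases ys) auto
    hence hd: "hd (ys @ [z]) \<noteq> y" "hd (ys @ [z]) \<noteq> x2" "y \<noteq> x"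
      using Cons.prems(3) Cons by auto
    hence nE: "\<not> E y x2" using thr(2) Cons.prems(1,5) by (auto dest: sympD)
    have "thread ?E (V - {x}) y (x2 # ys) z"
    proof -
      have "thread ?E (V - {x}) x2 ys z"
        by (rule thread_mono[OF thr(3)]) (use Cons.prems(3) Cons in \<open>auto simp: add_edge_def\<close>)
      thus ?thesis using thr(2) by (auto simp: add_edge_def)
    qed
    moreover have "\<not> ?E u u" if "u \<in> set xs" for u
      using Cons.prems(3,8) that Cons by (auto simp: add_edge_def)
    ultimately have "\<exists>t. symp t \<and> (\<forall>k. frust_le k (add_edge y z ?E) t (V - {x} - set xs)
        \<longrightarrow> frust_le k ?E ?s (V - {x}))"
      using Cons.prems Cons hd
      by (intro Cons.IH symp_add_edge symp_set_sign) (auto simp: add_edge_def)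
    then obtain t where t: "symp t"
      "\<And>k. frust_le k (add_edge y z ?E) t (V - {x} - set xs) \<Longrightarrow> frust_le k ?E ?s (V - {x})"
      by blast
    have "frust_le k E s V" if "frust_le k (add_edge y z E) t (V - set (x # xs))" for k
    proof (rule frust_le_suppress[where x = x and y = y and z = x2])
      \<comment> \<open>\<open>x2\<close> belongs to \<open>xs\<close>, so the intermediate edge
        from \<open>y\<close> to \<open>x2\<close> has already left the graph.\<close>
      have "frust_le k (add_edge y z ?E) t (V - {x} - set xs)"
      proof (rule frust_le_mono)
        show "frust_le k (add_edge y z E) t (V - {x} - set xs)"
          using that by (metis Diff_insert2 list.simps(15))
      qed (auto simp: add_edge_def Cons)
      thus "frust_le k ?E ?s (V - {x})" by (rule t(2))
    qed (use Cons.prems thr nE Cons in auto)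
    thus ?thesis using t(1) by blast
  qed
qed simp

text \<open>The two colourings are glued after flipping the one on \<open>B\<close> if the crossing edge \<open>pq\<close> demands it.\<close>

lemma frust_le_bridge:
  assumes A: "frust_le j E s A" and B: "frust_le k E s B" and "finite A" "finite B" "A \<inter> B = {}"
    and "symp E" "symp s"
    and cross: "\<And>u v. u \<in> A \<Longrightarrow> v \<in> B \<Longrightarrow> E u v \<Longrightarrow> u = p \<and> v = q"
  shows "frust_le (j + k) E s (A \<union> B)"
proof -
  obtain D c where D: "D \<subseteq> A" "card D \<le> j" "balanced_by E s (A - D) c"
    using A unfolding frust_le_def by blast
  obtain F d where F: "F \<subseteq> B" "card F \<le> k" "balanced_by E s (B - F) d"
    using B unfolding frust_le_def by blast
  define flip where "flip = ((c p \<noteq> d q) \<noteq> s p q)"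
  define e where "e = (\<lambda>u. if u \<in> A then c u else d u \<noteq> flip)"
  have AB: "(e u \<noteq> e v) = s u v" if "u \<in> A" "v \<in> B" "E u v" for u v
    using cross[OF that] that assms(5) by (auto simp: e_def flip_def)
  have "(e u \<noteq> e v) = s u v" if uv: "u \<in> A \<union> B - (D \<union> F)" "v \<in> A \<union> B - (D \<union> F)" "E u v" for u v
  proof -
    have sy: "s u v = s v u" "E v u" using assms(6,7) that by (auto dest: sympD)
    consider "u \<in> A" "v \<in> A" | "u \<in> A" "v \<in> B" | "v \<in> A" "u \<in> B" | "u \<in> B" "v \<in> B" using uv(1,2) by blast
    thus ?thesis
    proof cases
      case 1 thus ?thesis using D(3) that unfolding balanced_by_def e_def by auto
    next
      case 2 thus ?thesis using AB that by blast
    next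
      case 3 thus ?thesis using AB sy by metis
    next
      case 4
      hence "(d u \<noteq> d v) = s u v" using F(3) that unfolding balanced_by_def by auto
      moreover have "u \<notin> A" "v \<notin> A" using 4 assms(5) by auto
      ultimately show ?thesis by (auto simp: e_def)
    qed
  qed
  moreover have "card (D \<union> F) \<le> j + k"
    using card_Un_le[of D F] D(2) F(2) by linarith
  ultimately show ?thesis unfolding frust_le_def balanced_by_def using D(1) F(1)
    by (intro exI[of _ "D \<union> F"] exI[of _ e]) auto
qed

section \<open>Closure properties of the graph class, and cubes as closed pieces\<close>

lemma tf_subcubic_subset: "tf_subcubic E V \<Longrightarrow> V' \<subseteq> V \<Longrightarrow> tf_subcubic E V'"
proof -
  assume a: "tf_subcubic E V" "V' \<subseteq> V"
  have "card {v\<in>V'. E u v} \<le> card {v\<in>V. E u v}" for u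
    using a by (intro card_mono) (auto simp: tf_subcubic_def)
  thus ?thesis using a unfolding tf_subcubic_def
    by (meson finite_subset order_trans subsetD)
qed

text \<open>Each end has lost a neighbour (\<open>y'\<close>, \<open>z'\<close>), which makes room
  for the new edge; a triangle through that edge needs a common neighbour of its ends in
  \<open>V'\<close>.\<close>

lemma tf_subcubic_add_edge:
  assumes tf: "tf_subcubic E V" and V': "V' \<subseteq> V" "y \<in> V'" "z \<in> V'" "y \<noteq> z"
    and y': "E y y'" "y' \<in> V - V'" and z': "E z z'" "z' \<in> V - V'"
    and com: "\<And>w. w \<in> V' \<Longrightarrow> E y w \<Longrightarrow> E z w \<Longrightarrow> False"
  shows "tf_subcubic (add_edge y z E) V'"
proof -
  have fin: "finite V" "finite V'" using tf V' finite_subset unfolding tf_subcubic_def by auto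
  have sy: "symp E" using tf unfolding tf_subcubic_def by simp
  have deg: "card {v\<in>V. E u v} \<le> 3" if "u \<in> V" for u using tf that unfolding tf_subcubic_def by simp
  have tri: "\<lbrakk>a \<in> V; b \<in> V; c \<in> V; E a b; E b c; E c a\<rbrakk> \<Longrightarrow> False" for a b c
    using tf unfolding tf_subcubic_def by blast
  have lost: "card {v\<in>V'. v = b \<or> E a v} \<le> 3" if "a \<in> V'" "E a a'" "a' \<in> V - V'" for a a' b
  proof -
    have "{v\<in>V'. v = b \<or> E a v} \<subseteq> insert b ({v\<in>V. E a v} - {a'})" using that V' by auto
    hence "card {v\<in>V'. v = b \<or> E a v} \<le> card (insert b ({v\<in>V. E a v} - {a'}))"
      using fin by (intro card_mono) auto
    also have "\<dots> \<le> Suc (card ({v\<in>V. E a v} - {a'}))" by (simp add: card_insert_le_m1)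
    also have "\<dots> = card {v\<in>V. E a v}"
      using that fin by (intro card_Suc_Diff1) auto
    also have "\<dots> \<le> 3" using deg that V' by auto
    finally show ?thesis .
  qed
  have "card {v\<in>V'. add_edge y z E u v} \<le> 3" if "u \<in> V'" for u
  proof -
    consider "u = y" | "u = z" | "u \<noteq> y" "u \<noteq> z" by blast
    thus ?thesis
    proof cases
      case 1
      have "{v\<in>V'. add_edge y z E u v} = {v\<in>V'. v = z \<or> E y v}"
        using 1 V' by (auto simp: add_edge_def)
      thus ?thesis using lost y' V' by simp
    next
      case 2
      have "{v\<in>V'. add_edge y z E u v} = {v\<in>V'. v = y \<or> E z v}"
        using 2 V' by (auto simp: add_edge_def)
      thus ?thesis using lost z' V' by simp
    next
      case 3
      have "card {v\<in>V'. add_edge y z E u v} \<le> card {v\<in>V. E u v}"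
        using 3 V' fin by (intro card_mono) (auto simp: add_edge_def)
      thus ?thesis using deg that V' by (meson order_trans subsetD)
    qed
  qed
  moreover have "\<not> add_edge y z E c a"
    if abc: "a \<in> V'" "b \<in> V'" "c \<in> V'" "add_edge y z E a b" "add_edge y z E b c" for a b c
  proof
    assume ca: "add_edge y z E c a"
    have nn: "\<not> E u u" if "u \<in> V'" for u using tri[of u u u] V' that by auto
    have new: False if "c = y \<and> a = z \<or> c = z \<and> a = y" "b \<in> V'"
      "add_edge y z E a b" "add_edge y z E b c" for a b c
    proof -
      have "b \<noteq> y" "b \<noteq> z" using that nn[OF V'(2)] nn[OF V'(3)] \<open>y \<noteq> z\<close>
        by (auto simp: add_edge_def)
      hence "E a b" "E b c" using that by (auto simp: add_edge_def)
      hence "E y b" "E z b" using that(1) sy by (auto dest: sympD)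
      thus False using com that(2) by blast
    qed
    show False
    proof (cases "E a b \<and> E b c \<and> E c a")
      case True
      thus ?thesis using tri[of a b c] V'(1) abc(1-3) by blast
    next
      case False
      hence "(c = y \<and> a = z \<or> c = z \<and> a = y) \<or> (a = y \<and> b = z \<or> a = z \<and> b = y) \<or>
          (b = y \<and> c = z \<or> b = z \<and> c = y)"
        using abc(4,5) ca by (auto simp: add_edge_def)
      thus ?thesis using new[of c a b] new[of a b c] new[of b c a] abc ca by blast
    qed
  qed
  ultimately show ?thesis unfolding tf_subcubic_def using fin symp_add_edge[OF sy] by blast
qed

text \<open>Three neighbours inside \<open>K\<close> exhaust the degree bound, so no edge leaves a
  cube. All arguments against new cubes rest on this.\<close>

lemma cube_on_closed:
  assumes "cube_on E K" "tf_subcubic E V" "K \<subseteq> V"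
  shows "card K = 8" and "\<And>u. u \<in> K \<Longrightarrow> card {v\<in>V. E u v} = 3"
    and "\<And>u v. u \<in> K \<Longrightarrow> v \<in> V \<Longrightarrow> E u v \<Longrightarrow> v \<in> K"
proof -
  have fin: "finite V" and sy: "symp E" using assms(2) unfolding tf_subcubic_def by auto
  obtain a1 a2 a3 a4 b1 b2 b3 b4 where K:
    "distinct [a1, a2, a3, a4, b1, b2, b3, b4]" "K = {a1, a2, a3, a4, b1, b2, b3, b4}"
    "E a1 a2" "E a2 a3" "E a3 a4" "E a4 a1"
    "E b1 b2" "E b2 b3" "E b3 b4" "E b4 b1"
    "E a1 b1" "E a2 b2" "E a3 b3" "E a4 b4"
    using assms(1) unfolding cube_on_def by blast
  show "card K = 8" using K(1,2) by simp
  note sym_edges = K(3-14)[THEN sympD[OF sy]]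
  have nbrs: "card {v\<in>V. E u v} = 3 \<and> {v\<in>V. E u v} \<subseteq> K"
    if "distinct [p, q, r]" "{u, p, q, r} \<subseteq> K" "E u p" "E u q" "E u r" for u p q r
  proof -
    have "card {p, q, r} = 3" using that(1) by simp
    moreover have "{p, q, r} \<subseteq> {v\<in>V. E u v}" using that assms(3) by auto
    moreover have "card {v\<in>V. E u v} \<le> 3"
      using assms(2,3) that(2) unfolding tf_subcubic_def by auto
    ultimately have "{p, q, r} = {v\<in>V. E u v}" using fin by (intro card_seteq) auto
    thus ?thesis using that(2) \<open>card {p, q, r} = 3\<close> by (metis insert_subset)
  qed
  have Na1: "card {v\<in>V. E a1 v} = 3 \<and> {v\<in>V. E a1 v} \<subseteq> K"
    by (rule nbrs[of a2 a4 b1 a1]) (use K(1) in \<open>auto simp add: K(2-) sym_edges\<close>)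
  have Na2: "card {v\<in>V. E a2 v} = 3 \<and> {v\<in>V. E a2 v} \<subseteq> K"
    by (rule nbrs[of a1 a3 b2 a2]) (use K(1) in \<open>auto simp add: K(2-) sym_edges\<close>)
  have Na3: "card {v\<in>V. E a3 v} = 3 \<and> {v\<in>V. E a3 v} \<subseteq> K"
    by (rule nbrs[of a2 a4 b3 a3]) (use K(1) in \<open>auto simp add: K(2-) sym_edges\<close>)
  have Na4: "card {v\<in>V. E a4 v} = 3 \<and> {v\<in>V. E a4 v} \<subseteq> K"
    by (rule nbrs[of a3 a1 b4 a4]) (use K(1) in \<open>auto simp add: K(2-) sym_edges\<close>)
  have Nb1: "card {v\<in>V. E b1 v} = 3 \<and> {v\<in>V. E b1 v} \<subseteq> K"
    by (rule nbrs[of b2 b4 a1 b1]) (use K(1) in \<open>auto simp add: K(2-) sym_edges\<close>)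
  have Nb2: "card {v\<in>V. E b2 v} = 3 \<and> {v\<in>V. E b2 v} \<subseteq> K"
    by (rule nbrs[of b1 b3 a2 b2]) (use K(1) in \<open>auto simp add: K(2-) sym_edges\<close>)
  have Nb3: "card {v\<in>V. E b3 v} = 3 \<and> {v\<in>V. E b3 v} \<subseteq> K"
    by (rule nbrs[of b2 b4 a3 b3]) (use K(1) in \<open>auto simp add: K(2-) sym_edges\<close>)
  have Nb4: "card {v\<in>V. E b4 v} = 3 \<and> {v\<in>V. E b4 v} \<subseteq> K"
    by (rule nbrs[of b3 b1 a4 b4]) (use K(1) in \<open>auto simp add: K(2-) sym_edges\<close>)
  have *: "card {v\<in>V. E u v} = 3 \<and> {v\<in>V. E u v} \<subseteq> K" if "u \<in> K" for u
    using that unfolding K(2)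
    by (elim insertE emptyE) (simp_all only: K(2)[symmetric] Na1 Na2 Na3 Na4 Nb1 Nb2 Nb3 Nb4 simp_thms)
  show "card {v\<in>V. E u v} = 3" if "u \<in> K" for u using *[OF that] by simp
  show "v \<in> K" if "u \<in> K" "v \<in> V" "E u v" for u v using *[OF that(1)] that by blast
qed

lemma cube_on_mono:
  assumes "cube_on E K" "\<And>u v. u \<in> K \<Longrightarrow> v \<in> K \<Longrightarrow> E u v \<Longrightarrow> E' u v"
  shows "cube_on E' K"
proof -
  obtain a1 a2 a3 a4 b1 b2 b3 b4 where K:
    "distinct [a1, a2, a3, a4, b1, b2, b3, b4]" "K = {a1, a2, a3, a4, b1, b2, b3, b4}"
    and edges: "E a1 a2" "E a2 a3" "E a3 a4" "E a4 a1"
    "E b1 b2" "E b2 b3" "E b3 b4" "E b4 b1"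
    "E a1 b1" "E a2 b2" "E a3 b3" "E a4 b4"
    using assms(1) unfolding cube_on_def by blast
  have "a1 \<in> K" "a2 \<in> K" "a3 \<in> K" "a4 \<in> K" "b1 \<in> K" "b2 \<in> K" "b3 \<in> K" "b4 \<in> K"
    using K(2) by simp_all
  hence "E' a1 a2" "E' a2 a3" "E' a3 a4" "E' a4 a1"
    "E' b1 b2" "E' b2 b3" "E' b3 b4" "E' b4 b1"
    "E' a1 b1" "E' a2 b2" "E' a3 b3" "E' a4 b4"
    using edges assms(2) by simp_all
  thus ?thesis using K unfolding cube_on_def by blast
qed

lemma cube_on_add_edge:
  assumes "cube_on (add_edge y z E) K" "\<not> cube_on E K"
  shows "y \<in> K \<and> z \<in> K"
  using cube_on_mono[OF assms(1), of E] assms(2) by (auto simp: add_edge_def)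

lemma tf_subcubicD:
  assumes "tf_subcubic E V"
  shows "finite V" "symp E" "\<And>u. u \<in> V \<Longrightarrow> card {v\<in>V. E u v} \<le> 3"
    "\<And>x y z. x \<in> V \<Longrightarrow> y \<in> V \<Longrightarrow> z \<in> V \<Longrightarrow> E x y \<Longrightarrow> E y z \<Longrightarrow> E z x \<Longrightarrow> False"
  using assms unfolding tf_subcubic_def by blast+

subsection \<open>Minimal counterexamples are cubic\<close>

text \<open>Minimality ranges over arbitrary relations and signs on the same vertex type, since
  suppression changes both. Confining \<open>E\<close> to \<open>V\<close> spares membership
  conditions.\<close>

locale frust_counterexample =
  fixes V :: "'a set" and E s :: "'a binrel"
  assumes tf: "tf_subcubic E V" and cf: "cube_free E V" and sgn: "symp s"
    and inV: "E u v \<Longrightarrow> u \<in> V"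
    and counter: "\<not> frust_le (card V div 3) E s V"
    and smaller: "\<And>(V' :: 'a set) E' s'. card V' < card V \<Longrightarrow> tf_subcubic E' V' \<Longrightarrow> cube_free E' V' \<Longrightarrow> symp s' \<Longrightarrow>
      frust_le (card V' div 3) E' s' V'"
begin

lemma fin: "finite V" using tf by (rule tf_subcubicD)

lemma sym: "E u v \<Longrightarrow> E v u" using tf_subcubicD(2)[OF tf] by (rule sympD)

lemma sgn_sym: "s u v = s v u" using sgn by (auto dest: sympD)

lemma inV2: "E u v \<Longrightarrow> v \<in> V" using sym inV by blast

lemma tri: "E x y \<Longrightarrow> E y z \<Longrightarrow> E z x \<Longrightarrow> False"
  using tf_subcubicD(4)[OF tf] inV by blast

lemma irr: "\<not> E x x" using tri by blast

text \<open>The accounting common to all reductions: \<open>d\<close> deletions are spent, and the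
  removal of \<open>X\<close> must lower the floor by at least \<open>d\<close>. By
  \<open>div3\<close> it suffices that \<open>X\<close> has \<open>3 * d\<close> elements.\<close>

lemma reduce:
  assumes X: "X \<subseteq> V" "X \<noteq> {}" and "tf_subcubic E' (V - X)" "cube_free E' (V - X)" "symp s'"
    and ext: "\<And>k. frust_le k E' s' (V - X) \<Longrightarrow> frust_le (k + d) E s V"
    and "card (V - X) div 3 + d \<le> card V div 3"
  shows False
proof -
  have "card (V - X) < card V" using X fin by (intro psubset_card_mono) auto
  hence "frust_le (card (V - X) div 3) E' s' (V - X)" using assms by (intro smaller)
  hence "frust_le (card (V - X) div 3 + d) E s V" by (rule ext)
  thus False using counter assms(7) unfolding frust_le_def by (meson order_trans)
qed

lemma div3:
  assumes "X \<subseteq> V" "3 * d \<le> card X"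
  shows "card (V - X) div 3 + d \<le> card V div 3"
proof -
  have "finite X" using assms(1) fin finite_subset by blast
  hence "card (V - X) = card V - card X" "card X \<le> card V"
    using assms(1) fin by (auto simp: card_Diff_subset card_mono)
  thus ?thesis using assms(2) by linarith
qed

lemma restrict_tf: "W \<subseteq> V \<Longrightarrow> tf_subcubic E W" using tf tf_subcubic_subset by blast

lemma restrict_cf: "W \<subseteq> V \<Longrightarrow> cube_free E W" using cf unfolding cube_free_def by blast

text \<open>Both sides are smaller, gluing across one edge costs no deletion, and the sum of the two
  floors is at most the floor of the whole. With dummies \<open>p\<close> and \<open>q\<close> this
  also rules out a disconnected counterexample.\<close>

lemma no_cut:
  assumes A: "A \<subseteq> V" "A \<noteq> {}" "A \<noteq> V" and cr: "\<And>u w. u \<in> A \<Longrightarrow> w \<in> V - A \<Longrightarrow> E u w \<Longrightarrow> u = p \<and> w = q"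
  shows False
proof -
  have "card A < card V" "card (V - A) < card V"
    using A fin by (auto intro!: psubset_card_mono)
  hence "frust_le (card A div 3) E s A" "frust_le (card (V - A) div 3) E s (V - A)"
    using A sgn by (auto intro!: smaller restrict_tf restrict_cf)
  hence "frust_le (card A div 3 + card (V - A) div 3) E s (A \<union> (V - A))"
    using fin A cr tf sgn by (intro frust_le_bridge[where p = p and q = q]) (auto dest: finite_subset tf_subcubicD)
  moreover have "card A + card (V - A) = card V"
    using A fin by (metis card_Diff_subset card_mono finite_subset le_add_diff_inverse)
  ultimately show False using counter A unfolding frust_le_def
    by (smt (verit) Un_Diff_cancel Un_absorb1 add.commute div_add1_eq le_add1 order_trans)
qed

text \<open>The second component of an entry is the only neighbour its vertex has left (a dummy if there
  is none).\<close>

fun peels :: "'a set \<Rightarrow> ('a \<times> 'a) list \<Rightarrow> bool" where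
  "peels W [] = True"
| "peels W ((x, p) # xs) = ((\<forall>v\<in>W. E x v \<longrightarrow> v = p) \<and> peels (W - {x}) xs)"

lemma frust_le_peels:
  assumes "frust_le k E s (W - fst ` set xs)" "peels W xs"
  shows "frust_le k E s W"
  using assms
proof (induction xs arbitrary: W)
  case (Cons a xs)
  obtain x p where a: "a = (x, p)" by force
  have "W - fst ` set (a # xs) = W - {x} - fst ` set xs" by (auto simp: a)
  moreover have px: "\<forall>v\<in>W. E x v \<longrightarrow> v = p" "peels (W - {x}) xs"
    using Cons.prems(2) by (simp_all add: a)
  ultimately have "frust_le k E s (W - {x})" using Cons by metis
  thus ?case by (rule frust_le_peel[OF _ tf_subcubicD(2)[OF tf] sgn irr]) (use px in blast)
qed simp

lemma frust_le_deletes: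
  assumes "frust_le k E s (V - D)" "D \<subseteq> V"
  shows "frust_le (k + card D) E s V"
proof -
  have "finite D" using assms(2) fin finite_subset by blast
  thus ?thesis using assms
  proof (induction D arbitrary: k)
    case (insert d D)
    have "frust_le (Suc k) E s (V - D)"
      using insert fin by (intro frust_le_delete[where d = d]) (auto simp: Diff_insert2[symmetric] insert_commute, metis Diff_insert)
    hence "frust_le (Suc k + card D) E s V" using insert.IH[of "Suc k"] insert.prems by simp
    thus ?case using insert.hyps by simp
  qed simp
qed

text \<open>The reduction that adds no edge: the graph class is kept for free, and only the count of
  deleted and peeled vertices matters.\<close>

lemma strip:
  assumes "D \<subseteq> V" "fst ` set xs \<subseteq> V" "peels (V - D) xs" "D \<noteq> {} \<or> xs \<noteq> []"
    and c: "3 * card D \<le> card (D \<union> fst ` set xs)"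
  shows False
proof (rule reduce[where X = "D \<union> fst ` set xs" and d = "card D" and E' = E and s' = s])
  fix k assume k: "frust_le k E s (V - (D \<union> fst ` set xs))"
  have "V - (D \<union> fst ` set xs) = V - D - fst ` set xs" by blast
  with k have "frust_le k E s (V - D)" using assms(3) frust_le_peels by metis
  thus "frust_le (k + card D) E s V" using assms(1) by (rule frust_le_deletes)
next
  show "card (V - (D \<union> fst ` set xs)) div 3 + card D \<le> card V div 3"
    using assms(1,2) c by (intro div3) auto
qed (use assms(1,2,4) sgn in \<open>auto intro!: restrict_tf restrict_cf\<close>)

lemma nbrs3:
  assumes "E u a" "E u b" "E u c" "a \<noteq> b" "a \<noteq> c" "b \<noteq> c"
  shows "E u v \<longleftrightarrow> v = a \<or> v = b \<or> v = c"
proof (rule ccontr)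
  assume "\<not> ?thesis"
  hence v: "E u v" "v \<noteq> a" "v \<noteq> b" "v \<noteq> c" using assms by auto
  have "card {a, b, c, v} = 4" using v assms by simp
  moreover have "card {a, b, c, v} \<le> card {v\<in>V. E u v}"
    using assms v fin inV2 by (intro card_mono) auto
  moreover have "\<dots> \<le> 3" using tf_subcubicD(3)[OF tf] inV[OF v(1)] by blast
  ultimately show False by simp
qed

lemma nbrs_two:
  assumes "E u a" "E u b" "a \<noteq> b"
  obtains p where "\<And>v. E u v \<Longrightarrow> v = a \<or> v = b \<or> v = p"
  using nbrs3[OF assms(1,2)] assms by metis

lemma no_leaf:
  assumes "x \<in> V" "\<And>v. E x v \<Longrightarrow> v = p" shows False
  by (rule strip[where D = "{}" and xs = "[(x, p)]"]) (use assms in auto)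

section \<open>Vertices of degree at most two\<close>

definition low :: "'a \<Rightarrow> bool" where
  "low v \<longleftrightarrow> v \<in> V \<and> (\<exists>x y. \<forall>w. E v w \<longrightarrow> w = x \<or> w = y)"

lemma low_nbrs:
  assumes "low v"
  obtains x y where "x \<noteq> y" "\<And>w. E v w \<longleftrightarrow> w = x \<or> w = y"
  using assms no_leaf[of v] unfolding low_def by metis

lemma low_other:
  assumes "low v" "E v x"
  obtains y where "x \<noteq> y" "\<And>w. E v w \<longleftrightarrow> w = x \<or> w = y"
  using low_nbrs[OF assms(1)] assms(2) by metis

text \<open>Deleting the other neighbour of \<open>v\<close> makes \<open>v\<close> and then
  \<open>w\<close> fall off: three vertices for one deletion.\<close>

lemma low_nonadj:
  assumes "low v" "low w" "E v w" shows False
proof -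
  obtain x where x: "w \<noteq> x" "\<And>u. E v u \<longleftrightarrow> u = w \<or> u = x" using low_other[OF assms(1,3)] by blast
  obtain y where y: "v \<noteq> y" "\<And>u. E w u \<longleftrightarrow> u = v \<or> u = y" using low_other[OF assms(2) sym[OF assms(3)]] by blast
  have "x \<noteq> v" "v \<noteq> w" using irr x assms by auto
  thus False
    by (intro strip[where D = "{x}" and xs = "[(v, w), (w, y)]"])
       (use x y assms inV2 inV in \<open>auto simp: low_def\<close>)
qed

text \<open>Deleting the shared neighbour \<open>x\<close> turns both vertices into leaves: again
  three for one.\<close>

lemma low_unique:
  assumes "low v" "low w" "E x v" "E x w" shows "v = w"
proof (rule ccontr)
  assume "v \<noteq> w"
  obtain y where y: "x \<noteq> y" "\<And>u. E v u \<longleftrightarrow> u = x \<or> u = y" using low_other[OF assms(1) sym[OF assms(3)]] by blast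
  obtain z where z: "x \<noteq> z" "\<And>u. E w u \<longleftrightarrow> u = x \<or> u = z" using low_other[OF assms(2) sym[OF assms(4)]] by blast
  have "x \<noteq> v" "x \<noteq> w" using irr assms by auto
  thus False
    by (intro strip[where D = "{x}" and xs = "[(v, y), (w, z)]"])
       (use y z assms inV \<open>v \<noteq> w\<close> in \<open>auto simp: low_def\<close>)
qed

lemma not_low_nbr:
  assumes "\<not> low u" "E u a" "E u b" "a \<noteq> b"
  obtains c where "c \<noteq> a" "c \<noteq> b" "\<And>v. E u v \<longleftrightarrow> v = a \<or> v = b \<or> v = c"
proof -
  obtain c where "E u c" "c \<noteq> a" "c \<noteq> b" using assms inV unfolding low_def by blast
  thus ?thesis using that[of c] nbrs3[of u a b c] assms by auto
qed

lemma not_low_nbr1: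
  assumes "\<not> low u" "E u a"
  obtains b c where "b \<noteq> a" "c \<noteq> a" "b \<noteq> c" "\<And>v. E u v \<longleftrightarrow> v = a \<or> v = b \<or> v = c"
proof -
  obtain b where "E u b" "b \<noteq> a" using assms inV unfolding low_def by blast
  thus ?thesis using not_low_nbr[OF assms, of b] that by metis
qed

lemma not_low_nbr0:
  assumes "u \<in> V" "\<not> low u"
  obtains a b c where "a \<noteq> b" "a \<noteq> c" "b \<noteq> c" "\<And>v. E u v \<longleftrightarrow> v = a \<or> v = b \<or> v = c"
proof -
  obtain a where "E u a" using assms unfolding low_def by blast
  from not_low_nbr1[OF assms(2) this] show ?thesis using that by metis
qed

text \<open>Suppressing \<open>v\<close> can create a cube only if \<open>G\<close> is a cube with one subdivided edge; then it
  suffices to delete \<open>x\<close>, because \<open>v\<close> falls off and seven vertices need at most two deletions.\<close>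

lemma low_in_four_cycle:
  assumes low: "low v" and N: "x \<noteq> y" "\<And>w. E v w \<longleftrightarrow> w = x \<or> w = y"
    and com: "\<And>z. E x z \<Longrightarrow> E y z \<Longrightarrow> z = v"
  shows False
proof -
  let ?E = "add_edge x y E" and ?s = "set_sign x y (s v x \<noteq> s v y) s"
  have vxy: "E v x" "E v y" using N(2) by simp_all
  have xy: "x \<in> V" "y \<in> V" "v \<in> V" "E x v" "E y v" "v \<noteq> x" "v \<noteq> y"
    using vxy inV2 inV sym irr by blast+
  have nxy: "\<not> E x y" using tri[of v x y] vxy sym by blast
  have tf': "tf_subcubic ?E (V - {v})"
  proof (rule tf_subcubic_add_edge[OF tf])
    show "False" if "w \<in> V - {v}" "E x w" "E y w" for w using com that by blast
  qed (use xy N(1) in auto)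
  have ext: "frust_le k E s V" if "frust_le k ?E ?s (V - {v})" for k
    by (rule frust_le_suppress[OF that tf_subcubicD(2)[OF tf] sgn irr]) (use N nxy xy in auto)
  have "\<not> cube_free ?E (V - {v})"
  proof
    assume cf': "cube_free ?E (V - {v})"
    show False
    proof (rule reduce[where X = "{v}" and d = 0, OF _ _ tf' cf' symp_set_sign[OF sgn]])
      show "frust_le (k + 0) E s V" if "frust_le k ?E ?s (V - {v})" for k
        using ext that by simp
      show "card (V - {v}) div 3 + 0 \<le> card V div 3"
        using card_Diff1_le[of V v] by (simp add: div_le_mono)
    qed (use xy in simp_all)
  qed
  then obtain K where K: "K \<subseteq> V - {v}" "cube_on ?E K" by (auto simp: cube_free_def)
  have "\<not> cube_on E K" using cf K(1) unfolding cube_free_def by blast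
  hence xyK: "x \<in> K" "y \<in> K" using cube_on_add_edge K(2) by metis+
  note cl = cube_on_closed[OF K(2) tf' K(1)]
  \<comment> \<open>No edge leaves \<open>insert v K\<close>, so the bridge passed to
    \<open>no_cut\<close> is a dummy.\<close>
  have VK: "V = insert v K"
  proof (rule ccontr)
    assume "V \<noteq> insert v K"
    moreover have "w \<in> insert v K" if "u \<in> insert v K" "w \<in> V" "E u w" for u w
      using that cl(3)[of u w] N(2) xyK by (auto simp: add_edge_def)
    ultimately show False
      by (intro no_cut[of "insert v K" v v]) (use K(1) xy in blast)+
  qed
  have "card V = 9" using cl(1) VK K(1) finite_subset[OF K(1)] fin by (subst VK, subst card_insert_disjoint) auto
  have "card (V - {x, v}) = 7" using \<open>card V = 9\<close> xy fin by (auto simp: card_Diff_subset)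
  show False
  proof (rule reduce[where X = "{x, v}" and d = 1 and E' = E and s' = s])
    fix k assume k: "frust_le k E s (V - {x, v})"
    have "frust_le k E s (V - {x} - fst ` set [(v, y)])"
      using k by (simp only: Diff_insert2[of V x "{v}"] list.set image_insert image_empty fst_conv)
    moreover have "peels (V - {x}) [(v, y)]" using N(2) by simp
    ultimately have "frust_le k E s (V - {x})" by (rule frust_le_peels)
    from frust_le_deletes[OF this] show "frust_le (k + 1) E s V" using xy by simp
  next
    show "card (V - {x, v}) div 3 + 1 \<le> card V div 3"
      by (simp only: \<open>card V = 9\<close> \<open>card (V - {x, v}) = 7\<close>) simp
  qed (use xy in \<open>auto intro: restrict_tf restrict_cf sgn\<close>)
qed

end

text \<open>A new cube contains \<open>y\<close> and, being closed under adjacency, also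
  \<open>u\<close>; but \<open>u\<close> has too few neighbours to lie on a cube.\<close>

lemma cube_free_add_edge:
  assumes tf: "tf_subcubic (add_edge y z E) W" and cf: "cube_free E W"
    and u: "u = y \<or> add_edge y z E y u" "u \<in> W"
    and nb: "\<And>w. w \<in> W \<Longrightarrow> add_edge y z E u w \<Longrightarrow> w = p \<or> w = q"
  shows "cube_free (add_edge y z E) W"
  unfolding cube_free_def
proof (intro allI impI notI)
  fix K assume K: "K \<subseteq> W" "cube_on (add_edge y z E) K"
  have "\<not> cube_on E K" using cf K(1) unfolding cube_free_def by blast
  hence "y \<in> K" using cube_on_add_edge K(2) by metis
  hence "u \<in> K" using cube_on_closed(3)[OF K(2) tf K(1)] u by blast
  hence "card {w\<in>W. add_edge y z E u w} = 3" using cube_on_closed(2)[OF K(2) tf K(1)] by blast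
  moreover have "card {w\<in>W. add_edge y z E u w} \<le> card {p, q}"
    using nb by (intro card_mono) auto
  moreover have "card {p, q} \<le> 2" by (simp add: card_insert_if)
  ultimately show False by simp
qed

context frust_counterexample begin

text \<open>The reduction with one new edge \<open>yz\<close>: \<open>y'\<close> and
  \<open>z'\<close> are the removed neighbours that make room for it, \<open>com\<close> prevents
  triangles, and \<open>u\<close> with its at most two neighbours \<open>p\<close>, \<open>q\<close>
  prevents cubes.\<close>

lemma reduce_add:
  assumes X: "X \<subseteq> V" "3 * d \<le> card X" and yz: "y \<in> V - X" "z \<in> V - X" "y \<noteq> z"
    and y': "E y y'" "y' \<in> X" and z': "E z z'" "z' \<in> X"
    and com: "\<And>w. w \<in> V - X \<Longrightarrow> E y w \<Longrightarrow> E z w \<Longrightarrow> False"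
    and u: "u = y \<or> E y u" "u \<in> V - X"
    and nb: "\<And>w. w \<in> V - X \<Longrightarrow> add_edge y z E u w \<Longrightarrow> w = p \<or> w = q"
    and "symp s'"
    and ext: "\<And>k. frust_le k (add_edge y z E) s' (V - X) \<Longrightarrow> frust_le (k + d) E s V"
  shows False
proof -
  have tf': "tf_subcubic (add_edge y z E) (V - X)"
    by (rule tf_subcubic_add_edge[OF tf _ yz y'(1) _ z'(1)]) (use X y' z' inV inV2 com in blast)+
  have "u = y \<or> add_edge y z E y u" using u by (auto simp: add_edge_def)
  hence cf': "cube_free (add_edge y z E) (V - X)"
    using cube_free_add_edge[OF tf' restrict_cf _ u(2) nb] by blast
  show False
    by (rule reduce[OF X(1) _ tf' cf' \<open>symp s'\<close> ext div3[OF X]]) (use y' in blast)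
qed

lemma symE: "symp E" using tf by (rule tf_subcubicD)

lemma step_delete: "frust_le k E s (W - {d}) \<Longrightarrow> W \<subseteq> V \<Longrightarrow> d \<in> W \<Longrightarrow> frust_le (Suc k) E s W"
  by (rule frust_le_delete[OF _ finite_subset[OF _ fin]])

lemma step_peel:
  "frust_le k E s (W - {x}) \<Longrightarrow> (\<And>v. v \<in> W \<Longrightarrow> E x v \<Longrightarrow> v = p) \<Longrightarrow> frust_le k E s W"
  by (rule frust_le_peel[OF _ symE sgn irr])

text \<open>Otherwise delete \<open>x\<close>, let \<open>v\<close> fall off and suppress
  \<open>z\<close> into an edge \<open>yc\<close>. The only old neighbour left to \<open>y\<close>
  is \<open>b\<close>, which is not adjacent to \<open>c\<close>, so neither a triangle nor a cube
  arises.\<close>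

lemma low_square:
  assumes N: "\<And>w. E v w \<longleftrightarrow> w = x \<or> w = y" "\<And>w. E x w \<longleftrightarrow> w = v \<or> w = z \<or> w = a"
    "\<And>w. E y w \<longleftrightarrow> w = v \<or> w = z \<or> w = b" "\<And>w. E z w \<longleftrightarrow> w = x \<or> w = y \<or> w = c"
    and d: "x \<noteq> y" "v \<noteq> z" "b \<noteq> v" "b \<noteq> z" "c \<noteq> x" "c \<noteq> y"
  shows "E c b"
proof (rule ccontr)
  assume cb: "\<not> E c b"
  have adj: "E v x" "E v y" "E x z" "E y z" "E z c" "E z y" "E y b" using N by simp_all
  have mem: "v \<in> V" "x \<in> V" "y \<in> V" "z \<in> V" "c \<in> V" using adj inV inV2 by blast+
  have ne: "v \<noteq> x" "v \<noteq> y" "x \<noteq> z" "y \<noteq> z" "c \<noteq> z"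
    using irr adj by blast+
  have "\<not> E v z" using N(1)[of z] ne by simp
  hence "c \<noteq> v" using adj sym by blast
  note ne = ne this
  have yc: "\<not> E y c" using tri[of y z c] adj sym by blast
  have "c \<noteq> b" using yc adj by blast
  let ?E = "add_edge y c E" and ?s = "set_sign y c (s z y \<noteq> s z c) s"
  show False
  proof (rule reduce_add[where X = "{x, v, z}" and d = 1 and y = y and z = c and y' = z and z' = z
        and u = y and p = b and q = c and s' = ?s])
    show "E c z" using adj sym by blast
    show False if "w \<in> V - {x, v, z}" "E y w" "E c w" for w
      using that N(3) cb by auto
    show "w = b \<or> w = c" if "w \<in> V - {x, v, z}" "add_edge y c E y w" for w
      using that N(3) by (auto simp: add_edge_def)
    fix k assume k: "frust_le k ?E ?s (V - {x, v, z})"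
    have "V - {x, v, z} = V - {x} - {v} - {z}" by blast
    with k have "frust_le k ?E ?s (V - {x} - {v} - {z})" by (simp only:)
    hence "frust_le k E s (V - {x} - {v})"
      by (rule frust_le_suppress[OF _ symE sgn irr]) (use ne d yc N(4) in auto)
    hence "frust_le k E s (V - {x})"
      by (rule step_peel[where p = y]) (use N(1) in simp)
    thus "frust_le (k + 1) E s V" using step_delete mem(2) by simp
  qed (use mem ne d N symp_set_sign[OF sgn] in auto)
qed

text \<open>\<open>low_square\<close>, used from both sides of the four-cycle, makes
  \<open>c\<close> adjacent to \<open>a\<close> and to \<open>b\<close>. The configuration is then
  so dense that two deletions unravel at least six vertices, whether or not
  \<open>a = b\<close>.\<close>

lemma no_low: "\<not> low v"
proof
  assume v: "low v"
  obtain x y where xy: "x \<noteq> y" and Nv: "\<And>w. E v w \<longleftrightarrow> w = x \<or> w = y" using low_nbrs[OF v] by blast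
  obtain z where z: "E x z" "E y z" "z \<noteq> v" using low_in_four_cycle[OF v xy Nv] by blast
  have xv: "E x v" "E y v" "E v x" "E v y" using Nv sym by blast+
  have "\<not> low z" using low_unique[OF v _ xv(1) z(1)] z(3) by blast
  then obtain c where c: "c \<noteq> x" "c \<noteq> y" and Nz: "\<And>w. E z w \<longleftrightarrow> w = x \<or> w = y \<or> w = c"
    using not_low_nbr[OF _ sym[OF z(1)] sym[OF z(2)] xy] by blast
  have "\<not> low x" "\<not> low y" using low_nonadj v xv by blast+
  obtain a where a: "a \<noteq> v" "a \<noteq> z" and Nx: "\<And>w. E x w \<longleftrightarrow> w = v \<or> w = z \<or> w = a"
    using not_low_nbr[OF \<open>\<not> low x\<close> xv(1) z(1)] z(3) by blast
  obtain b where b: "b \<noteq> v" "b \<noteq> z" and Ny: "\<And>w. E y w \<longleftrightarrow> w = v \<or> w = z \<or> w = b"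
    using not_low_nbr[OF \<open>\<not> low y\<close> xv(2) z(2)] z(3) by blast
  have cb: "E c b" using low_square[OF Nv Nx Ny Nz xy z(3)[symmetric] b c] .
  have ca: "E c a" 
    by (rule low_square[of v y x z b a c]) (use Nv Nx Ny Nz xy z a c in blast)+
  have cz: "E c z" using Nz[of c] sym by simp
  have mem: "v \<in> V" "x \<in> V" "y \<in> V" "z \<in> V" "a \<in> V" "b \<in> V" "c \<in> V"
    using xv z ca cb inV inV2 by blast+
  have ax: "E a x" "E b y" "E a c" "E b c" using Nx[of a] Ny[of b] sym ca cb by simp_all
  have nxy: "\<not> E x y" "\<not> E y x" using tri[of v x y] xv sym by blast+
  have nvz: "\<not> E v z" using Nv[of z] z irr by metis
  have ne: "x \<noteq> v" "y \<noteq> v" "x \<noteq> z" "y \<noteq> z" "z \<noteq> c" "a \<noteq> c" "b \<noteq> c" "a \<noteq> x" "b \<noteq> y" "a \<noteq> y" "b \<noteq> x" "c \<noteq> v"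
    using irr xv z cz ca cb ax nxy nvz sym by blast+
  show False
  proof (cases "a = b")
    case True
    obtain c' where c': "\<And>w. E c w \<Longrightarrow> w = z \<or> w = a \<or> w = c'" using nbrs_two[OF cz ca] a(2) by blast
    have Na: "E a w \<longleftrightarrow> w = x \<or> w = y \<or> w = c" for w
      using nbrs3[of a x y c] ax True xy ne c by blast
    show False
    proof (rule strip[where D = "{x, y}" and xs = "[(v, v), (z, c), (a, c), (c, c')]"])
      show "peels (V - {x, y}) [(v, v), (z, c), (a, c), (c, c')]"
        using Nv Nz Na by (auto dest: c')
    qed (use mem xy ne a c z True in auto)
  next
    case False
    obtain a' where a': "\<And>w. E a w \<Longrightarrow> w = x \<or> w = c \<or> w = a'"
      using nbrs_two[OF ax(1,3)] c by blast
    obtain b' where b': "\<And>w. E b w \<Longrightarrow> w = y \<or> w = c \<or> w = b'"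
      using nbrs_two[OF ax(2,4)] c by blast
    show False
    proof (rule strip[where D = "{c, x}" and xs = "[(v, y), (z, y), (y, b), (a, a'), (b, b')]"])
      show "peels (V - {c, x}) [(v, y), (z, y), (y, b), (a, a'), (b, b')]"
        using Nv Nz Ny by (auto dest: a' b')
    qed (use mem xy ne a b c z False in auto)
  qed
qed

lemma nbr2:
  assumes "E u a" "E u b" "a \<noteq> b"
  obtains c where "c \<noteq> a" "c \<noteq> b" "\<And>v. E u v \<longleftrightarrow> v = a \<or> v = b \<or> v = c"
  using not_low_nbr[OF no_low assms] by blast

subsection \<open>Complete bipartite subgraphs and deletion of a star\<close>

text \<open>Deleting \<open>p\<close> and \<open>q\<close> leaves \<open>a\<close> and
  \<open>b\<close> hanging off \<open>e\<close> and \<open>c\<close> off its last neighbour; then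
  \<open>e\<close> is a leaf too. Six vertices for two deletions.\<close>

lemma K23_common_nbr:
  assumes E: "E p a" "E p b" "E p c" "E q a" "E q b" "E q c"
    and d: "p \<noteq> q" "a \<noteq> b" "a \<noteq> c" "b \<noteq> c"
    and e: "E a e" "E b e" "e \<noteq> p" "e \<noteq> q"
  shows False
proof -
  note S = E[THEN sym] e(1,2)[THEN sym]
  have Na: "E a w \<longleftrightarrow> w = p \<or> w = q \<or> w = e" for w using nbrs3[OF S(1,4) e(1)] d e by blast
  have Nb: "E b w \<longleftrightarrow> w = p \<or> w = q \<or> w = e" for w using nbrs3[OF S(2,5) e(2)] d e by blast
  obtain c' where Nc: "\<And>w. E c w \<longleftrightarrow> w = p \<or> w = q \<or> w = c'" using nbr2[OF S(3,6) d(1)] by blast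
  obtain e' where Ne: "\<And>w. E e w \<longleftrightarrow> w = a \<or> w = b \<or> w = e'" using nbr2[OF S(7,8) d(2)] by blast
  have "e \<noteq> c" using tri[of a c p] e S E by blast
  have mem: "p \<in> V" "q \<in> V" "a \<in> V" "b \<in> V" "c \<in> V" "e \<in> V" using E e inV inV2 by blast+
  have ne: "a \<noteq> p" "a \<noteq> q" "b \<noteq> p" "b \<noteq> q" "c \<noteq> p" "c \<noteq> q" "a \<noteq> e" "b \<noteq> e" using irr E e by blast+
  show False
  proof (rule strip[where D = "{p, q}" and xs = "[(a, e), (b, e), (c, c'), (e, e')]"])
    show "peels (V - {p, q}) [(a, e), (b, e), (c, c'), (e, e')]"
      using Na Nb Nc Ne by auto
  qed (use mem ne d e \<open>e \<noteq> c\<close> in auto)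
qed

text \<open>Delete \<open>c\<close> and suppress \<open>p\<close> into an edge \<open>ab\<close>. As
  the four-cycle \<open>paqb\<close> is balanced, the path through \<open>q\<close> demands the same
  sign, so \<open>q\<close> is free: three vertices for one deletion. \<open>K23_common_nbr\<close>
  keeps the new edge out of triangles.\<close>

lemma K23_balanced:
  assumes E: "E p a" "E p b" "E p c" "E q a" "E q b" "E q c"
    and d: "p \<noteq> q" "a \<noteq> b" "a \<noteq> c" "b \<noteq> c"
    and bal: "(s p a \<noteq> s p b) = (s q a \<noteq> s q b)"
  shows False
proof -
  note S = E[THEN sym]
  obtain a' where Na: "\<And>w. E a w \<longleftrightarrow> w = p \<or> w = q \<or> w = a'" using nbr2[OF S(1,4) d(1)] by blast
  have Np: "E p w \<longleftrightarrow> w = a \<or> w = b \<or> w = c" for w using nbrs3[OF E(1-3)] d by blast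
  have Nq: "E q w \<longleftrightarrow> w = a \<or> w = b \<or> w = c" for w using nbrs3[OF E(4-6)] d by blast
  have mem: "p \<in> V" "q \<in> V" "a \<in> V" "b \<in> V" "c \<in> V" using E inV inV2 by blast+
  have ne: "a \<noteq> p" "a \<noteq> q" "b \<noteq> p" "b \<noteq> q" "c \<noteq> p" "c \<noteq> q" using irr E by blast+
  have nab: "\<not> E a b" using tri E S by blast
  let ?E = "add_edge a b E" and ?s = "set_sign a b (s p a \<noteq> s p b) s"
  have irr': "\<not> ?E q q" using irr ne by (auto simp: add_edge_def)
  show False
  proof (rule reduce_add[where X = "{c, p, q}" and d = 1 and y = a and z = b and y' = p and z' = p
        and u = a and p = a' and q = b and s' = ?s])
    show False if "w \<in> V - {c, p, q}" "E a w" "E b w" for w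
      using K23_common_nbr[OF E d that(2,3)] that(1) by blast
    show "w = a' \<or> w = b" if "w \<in> V - {c, p, q}" "?E a w" for w
      using that Na d by (auto simp: add_edge_def)
    fix k assume k: "frust_le k ?E ?s (V - {c, p, q})"
    have "V - {c, p, q} = V - {c} - {p} - {q}" by blast
    with k have "frust_le k ?E ?s (V - {c} - {p} - {q})" by (simp only:)
    hence "frust_le k ?E ?s (V - {c} - {p})"
      by (rule frust_le_drop[OF _ symp_add_edge[OF symE] symp_set_sign[OF sgn] irr',
            where y = a and z = b])
        (use ne d Nq bal in \<open>auto simp: add_edge_def set_sign_def\<close>)
    hence "frust_le k E s (V - {c})"
      by (rule frust_le_suppress[OF _ symE sgn irr]) (use ne d nab Np in auto)
    thus "frust_le (k + 1) E s V" using step_delete mem by simp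
  qed (use mem ne d E S symp_set_sign[OF sgn] in auto)
qed

text \<open>The signs of the three four-cycles multiply to one, so one of them is balanced.\<close>

lemma no_K23:
  assumes "E p a" "E p b" "E p c" "E q a" "E q b" "E q c" "p \<noteq> q" "a \<noteq> b" "a \<noteq> c" "b \<noteq> c"
  shows False
proof -
  consider "(s p a \<noteq> s p b) = (s q a \<noteq> s q b)" | "(s p a \<noteq> s p c) = (s q a \<noteq> s q c)"
    | "(s p b \<noteq> s p c) = (s q b \<noteq> s q c)" by blast
  thus False
    using K23_balanced[of p a b c q] K23_balanced[of p a c b q] K23_balanced[of p b c a q] assms
    by cases blast+
qed

text \<open>Delete \<open>v\<close> and suppress its neighbours \<open>x\<close> and \<open>y\<close>. The third neighbour \<open>z\<close> now has degree two,
  so a cube created by the new edges would be attached to the rest by a bridge.\<close>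

lemma star_suppress:
  assumes Nv: "\<And>w. E v w \<longleftrightarrow> w = x \<or> w = y \<or> w = z"
    and Nx: "\<And>w. E x w \<longleftrightarrow> w = v \<or> w = x1 \<or> w = x2"
    and Ny: "\<And>w. E y w \<longleftrightarrow> w = v \<or> w = y1 \<or> w = y2"
    and d: "x \<noteq> y" "x \<noteq> z" "y \<noteq> z" "x1 \<noteq> v" "x2 \<noteq> v" "x1 \<noteq> x2" "y1 \<noteq> v" "y2 \<noteq> v" "y1 \<noteq> y2"
    and Px: "\<And>w. E x1 w \<Longrightarrow> E x2 w \<Longrightarrow> w = x"
    and Py: "\<And>w. E y1 w \<Longrightarrow> E y2 w \<Longrightarrow> w = y"
    and mixed: "\<And>p q r. E x p \<Longrightarrow> E x q \<Longrightarrow> E y p \<Longrightarrow> E y r \<Longrightarrow> p \<noteq> v \<Longrightarrow> q \<noteq> v \<Longrightarrow> r \<noteq> v \<Longrightarrow>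
      p \<noteq> q \<Longrightarrow> p \<noteq> r \<Longrightarrow> \<not> E q r"
  shows False
proof -
  have adj: "E v x" "E v y" "E v z" "E x v" "E x x1" "E x x2" "E y v" "E y y1" "E y y2"
    using Nv Nx Ny by simp_all
  have adj': "E z v" "E x1 x" "E x2 x" "E y1 y" "E y2 y" using adj sym by blast+
  have mem: "v \<in> V" "x \<in> V" "y \<in> V" "z \<in> V" "x1 \<in> V" "x2 \<in> V" "y1 \<in> V" "y2 \<in> V"
    using adj inV inV2 by blast+
  have nxy: "\<not> E x y" "\<not> E x z" "\<not> E y z" "\<not> E y x" "\<not> E z x" "\<not> E z y" using tri adj sym by blast+
  have nx: "\<not> E x1 x2" "\<not> E y1 y2" using tri adj adj' by blast+
  have ne: "v \<noteq> x" "v \<noteq> y" "v \<noteq> z" "x1 \<noteq> x" "x2 \<noteq> x" "y1 \<noteq> y" "y2 \<noteq> y"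
    "x1 \<noteq> y" "x2 \<noteq> y" "y1 \<noteq> x" "y2 \<noteq> x" "x1 \<noteq> z" "x2 \<noteq> z" "y1 \<noteq> z" "y2 \<noteq> z"
    using irr adj nxy by blast+
  \<comment> \<open>The two new edges must not coincide, or the second suppression would overwrite
    the sign of the first.\<close>
  have diff: "\<not> (y1 = x1 \<and> y2 = x2 \<or> y1 = x2 \<and> y2 = x1)" using Px[of y] adj' d by blast
  let ?E1 = "add_edge x1 x2 E" and ?s1 = "set_sign x1 x2 (s x x1 \<noteq> s x x2) s"
  let ?E2 = "add_edge y1 y2 ?E1" and ?s2 = "set_sign y1 y2 (?s1 y y1 \<noteq> ?s1 y y2) ?s1"
  have tf1: "tf_subcubic ?E1 (V - {v, x})"
  proof (rule tf_subcubic_add_edge[OF tf _ _ _ _ adj'(2) _ adj'(3)])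
    show False if "w \<in> V - {v, x}" "E x1 w" "E x2 w" for w using Px that by blast
  qed (use mem ne d in auto)
  let ?W = "V - {v, x, y}"
  have tf2: "tf_subcubic ?E2 ?W"
  proof (rule tf_subcubic_add_edge[OF tf1, where y' = y and z' = y])
    show False if w: "w \<in> ?W" "?E1 y1 w" "?E1 y2 w" for w
    proof -
      \<comment> \<open>In the last four cases the triangle uses the first new edge, which shares an
        end with the second; \<open>mixed\<close> is tailored to them.\<close>
      consider "E y1 w" "E y2 w" | "E y1 w" "y2 = x1" "w = x2" | "E y1 w" "y2 = x2" "w = x1"
        | "E y2 w" "y1 = x1" "w = x2" | "E y2 w" "y1 = x2" "w = x1"
        using w diff d by (auto simp: add_edge_def)
      thus False
      proof cases
        case 1 thus ?thesis using Py[of w] w by blast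
      next
        case 2 thus ?thesis using mixed[of x1 x2 y1] adj d sym by metis
      next
        case 3 thus ?thesis using mixed[of x2 x1 y1] adj d sym by metis
      next
        case 4 thus ?thesis using mixed[of x1 x2 y2] adj d sym by metis
      next
        case 5 thus ?thesis using mixed[of x2 x1 y2] adj d sym by metis
      qed
    qed
  qed (use mem ne d adj' in \<open>auto simp: add_edge_def\<close>)
  have cf2: "cube_free ?E2 ?W"
    unfolding cube_free_def
  proof (intro allI impI notI)
    fix K assume K: "K \<subseteq> ?W" "cube_on ?E2 K"
    note cl = cube_on_closed[OF K(2) tf2 K(1)]
    obtain z1 z2 where Nz: "\<And>w. E z w \<longleftrightarrow> w = v \<or> w = z1 \<or> w = z2"
      using not_low_nbr1[OF no_low adj'(1)] by blast
    have zK: "z \<notin> K"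
    proof
      assume "z \<in> K"
      hence "card {w\<in>?W. ?E2 z w} = 3" by (rule cl(2))
      moreover have "card {w\<in>?W. ?E2 z w} \<le> card {z1, z2}"
        using Nz ne by (intro card_mono) (auto simp: add_edge_def)
      moreover have "card {z1, z2} \<le> 2" by (simp add: card_insert_if)
      ultimately show False by simp
    qed
    have out: "w \<in> K \<or> w = v \<or> w = x \<or> w = y" if "u \<in> K" "w \<in> V" "E u w" for u w
      using cl(3)[OF that(1), of w] that by (auto simp: add_edge_def)
    have xx: "x1 \<in> K \<longleftrightarrow> x2 \<in> K" using cl(3)[of x1 x2] cl(3)[of x2 x1] mem ne d by (auto simp: add_edge_def)
    have yy: "y1 \<in> K \<longleftrightarrow> y2 \<in> K" using cl(3)[of y1 y2] cl(3)[of y2 y1] mem ne d by (auto simp: add_edge_def)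
    have ux: "u = v \<or> u = x1 \<or> u = x2" if "E u x" for u using Nx sym[OF that] by blast
    have uy: "u = v \<or> u = y1 \<or> u = y2" if "E u y" for u using Ny sym[OF that] by blast
    have uv: "u = x \<or> u = y \<or> u = z" if "E u v" for u using Nv sym[OF that] by blast
    have nK: "v \<notin> K" "x \<notin> K" "y \<notin> K" using K(1) by auto
    \<comment> \<open>Put suppressed vertices back: the cube then hangs on the rest by the single
      edge \<open>vz\<close>, \<open>xv\<close> or \<open>yv\<close>. Without either new edge it
      would be an old cube.\<close>
    consider "x1 \<in> K" "y1 \<in> K" | "x1 \<in> K" "y1 \<notin> K" | "x1 \<notin> K" "y1 \<in> K" | "x1 \<notin> K" "y1 \<notin> K" by blast
    thus False
    proof cases
      case 1
      show False
      proof (rule no_cut[of "insert v (insert x (insert y K))" v z])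
        show "u = v \<and> w = z" if "u \<in> insert v (insert x (insert y K))"
            "w \<in> V - insert v (insert x (insert y K))" "E u w" for u w
          using that out[of u w] Nv[of w] Nx[of w] Ny[of w] 1 xx yy by auto
      qed (use K(1) mem zK ne d in auto)
    next
      case 2
      show False
      proof (rule no_cut[of "insert x K" x v])
        show "u = x \<and> w = v" if "u \<in> insert x K" "w \<in> V - insert x K" "E u w" for u w
          using that out[of u w] Nx[of w] 2 xx yy uy[of u] uv[of u] nK zK by auto
      qed (use K(1) mem zK ne d in auto)
    next
      case 3
      show False
      proof (rule no_cut[of "insert y K" y v])
        show "u = y \<and> w = v" if "u \<in> insert y K" "w \<in> V - insert y K" "E u w" for u w
          using that out[of u w] Ny[of w] 3 xx yy ux[of u] uv[of u] nK zK by auto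
      qed (use K(1) mem zK ne d in auto)
    next
      case 4
      have "\<not> cube_on ?E1 K" using cube_on_add_edge[of x1 x2 E K] 4 cf K(1) unfolding cube_free_def by blast
      thus False using cube_on_add_edge[OF K(2)] 4 by blast
    qed
  qed
  show False
  proof (rule reduce[OF _ _ tf2 cf2])
    show "symp ?s2" by (intro symp_set_sign sgn)
    fix k assume k: "frust_le k ?E2 ?s2 ?W"
    have "V - {v, x, y} = V - {v} - {x} - {y}" by blast
    with k have "frust_le k ?E2 ?s2 (V - {v} - {x} - {y})" by (simp only:)
    hence "frust_le k ?E1 ?s1 (V - {v} - {x})"
      by (rule frust_le_suppress[OF _ symp_add_edge[OF symE] symp_set_sign[OF sgn]])
        (use ne d nx diff irr Ny nxy in \<open>auto simp: add_edge_def\<close>)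
    hence "frust_le k E s (V - {v})"
      by (rule frust_le_suppress[OF _ symE sgn irr]) (use ne d nx Nx in auto)
    thus "frust_le (k + 1) E s V" using step_delete mem by simp
  next
    show "card ?W div 3 + 1 \<le> card V div 3"
      by (rule div3) (use mem ne d in auto)
  qed (use mem in auto)
qed

end

context frust_counterexample begin

subsection \<open>Four-cycles\<close>

text \<open>A four-cycle \<open>u\<^sub>1u\<^sub>2u\<^sub>3u\<^sub>4\<close> in which \<open>w\<^sub>i\<close> is the neighbour of \<open>u\<^sub>i\<close> off the cycle.\<close>

definition square :: "'a \<Rightarrow> 'a \<Rightarrow> 'a \<Rightarrow> 'a \<Rightarrow> 'a \<Rightarrow> 'a \<Rightarrow> 'a \<Rightarrow> 'a \<Rightarrow> bool" where
  "square u1 u2 u3 u4 w1 w2 w3 w4 \<longleftrightarrow>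
     (\<forall>w. E u1 w \<longleftrightarrow> w = u2 \<or> w = u4 \<or> w = w1) \<and> (\<forall>w. E u2 w \<longleftrightarrow> w = u3 \<or> w = u1 \<or> w = w2) \<and>
     (\<forall>w. E u3 w \<longleftrightarrow> w = u4 \<or> w = u2 \<or> w = w3) \<and> (\<forall>w. E u4 w \<longleftrightarrow> w = u1 \<or> w = u3 \<or> w = w4) \<and>
     distinct [u1, u2, u3, u4, w1, w2, w3, w4]"

lemma square_rot: "square u1 u2 u3 u4 w1 w2 w3 w4 \<Longrightarrow> square u2 u3 u4 u1 w2 w3 w4 w1"
  unfolding square_def by (elim conjE) (intro conjI; (assumption | force))

lemma squareD:
  assumes "square u1 u2 u3 u4 w1 w2 w3 w4"
  shows "E u1 w \<longleftrightarrow> w = u2 \<or> w = u4 \<or> w = w1" "E u2 w \<longleftrightarrow> w = u3 \<or> w = u1 \<or> w = w2"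
    "E u3 w \<longleftrightarrow> w = u4 \<or> w = u2 \<or> w = w3" "E u4 w \<longleftrightarrow> w = u1 \<or> w = u3 \<or> w = w4"
    "distinct [u1, u2, u3, u4, w1, w2, w3, w4]"
  using assms unfolding square_def by blast+

lemma square_edges:
  assumes "square u1 u2 u3 u4 w1 w2 w3 w4"
  shows "E u1 u2" "E u2 u3" "E u3 u4" "E u4 u1" "E u1 w1" "E u2 w2" "E u3 w3" "E u4 w4"
    "E u2 u1" "E u3 u2" "E u4 u3" "E u1 u4" "E w1 u1" "E w2 u2" "E w3 u3" "E w4 u4"
    "u1 \<in> V" "u2 \<in> V" "u3 \<in> V" "u4 \<in> V" "w1 \<in> V" "w2 \<in> V" "w3 \<in> V" "w4 \<in> V"
proof -
  show e: "E u1 u2" "E u2 u3" "E u3 u4" "E u4 u1" "E u1 w1" "E u2 w2" "E u3 w3" "E u4 w4"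
    by (simp_all add: squareD(1-4)[OF assms])
  show e': "E u2 u1" "E u3 u2" "E u4 u3" "E u1 u4" "E w1 u1" "E w2 u2" "E w3 u3" "E w4 u4"
    using e[THEN sym] .
  show "u1 \<in> V" "u2 \<in> V" "u3 \<in> V" "u4 \<in> V" "w1 \<in> V" "w2 \<in> V" "w3 \<in> V" "w4 \<in> V"
    using e(1-4)[THEN inV] e'(5-8)[THEN inV] .
qed

text \<open>Outer neighbours of adjacent vertices differ by triangle-freeness, those of opposite
  vertices by \<open>no_K23\<close>.\<close>

lemma square_ex:
  assumes e: "E u1 u2" "E u2 u3" "E u3 u4" "E u4 u1" and d: "u1 \<noteq> u3" "u2 \<noteq> u4"
  obtains w1 w2 w3 w4 where "square u1 u2 u3 u4 w1 w2 w3 w4"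
proof -
  note e' = e[THEN sym]
  obtain w1 where w1: "w1 \<noteq> u2" "w1 \<noteq> u4" "\<And>w. E u1 w \<longleftrightarrow> w = u2 \<or> w = u4 \<or> w = w1"
    using nbr2[OF e(1) e'(4) d(2)] by blast
  obtain w2 where w2: "w2 \<noteq> u3" "w2 \<noteq> u1" "\<And>w. E u2 w \<longleftrightarrow> w = u3 \<or> w = u1 \<or> w = w2"
    using nbr2[OF e(2) e'(1) d(1)[symmetric]] by blast
  obtain w3 where w3: "w3 \<noteq> u4" "w3 \<noteq> u2" "\<And>w. E u3 w \<longleftrightarrow> w = u4 \<or> w = u2 \<or> w = w3"
    using nbr2[OF e(3) e'(2) d(2)[symmetric]] by blast
  obtain w4 where w4: "w4 \<noteq> u1" "w4 \<noteq> u3" "\<And>w. E u4 w \<longleftrightarrow> w = u1 \<or> w = u3 \<or> w = w4"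
    using nbr2[OF e(4) e'(3) d(1)] by blast
  have f: "E u1 w1" "E u2 w2" "E u3 w3" "E u4 w4" using w1(3) w2(3) w3(3) w4(3) by simp_all
  note f' = f[THEN sym]
  have "w1 \<noteq> w2" "w2 \<noteq> w3" "w3 \<noteq> w4" "w4 \<noteq> w1" using tri e e' f f' by blast+
  moreover have "\<not> E u1 u3" "\<not> E u2 u4" using tri e e' by blast+
  hence "w1 \<noteq> u3" "w2 \<noteq> u4" "w3 \<noteq> u1" "w4 \<noteq> u2" using f sym by blast+
  moreover have "w1 \<noteq> w3" using no_K23[OF e(1) e'(4) f(1) e'(2) e(3)] f(3) d w1 w3 by blast
  moreover have "w2 \<noteq> w4" using no_K23[OF e(2) e'(1) f(2) e'(3) e(4)] f(4) d w2 w4 by blast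
  moreover have "w1 \<noteq> u1" "w2 \<noteq> u2" "w3 \<noteq> u3" "w4 \<noteq> u4" "u1 \<noteq> u2" "u2 \<noteq> u3" "u3 \<noteq> u4" "u4 \<noteq> u1"
    using irr e f by blast+
  ultimately have "distinct [u1, u2, u3, u4, w1, w2, w3, w4]" using d w1(1,2) w2(1,2) w3(1,2) w4(1,2) by simp
  thus ?thesis using w1(3) w2(3) w3(3) w4(3) by (intro that[of w1 w2 w3 w4]) (simp add: square_def)
qed

text \<open>Otherwise \<open>star_suppress\<close> applies at \<open>u1\<close>, suppressing
  \<open>u2\<close> and \<open>u4\<close>: each of its side conditions could be violated only by an
  edge among \<open>w2\<close>, \<open>w3\<close>, \<open>w4\<close>.\<close>

lemma square_outer_edge:
  assumes sq: "square u1 u2 u3 u4 w1 w2 w3 w4"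
  shows "E w2 w3 \<or> E w3 w4 \<or> E w2 w4"
proof (rule ccontr)
  assume c: "\<not> ?thesis"
  note N = squareD(1-4)[OF sq] and e = square_edges[OF sq]
  have d: "distinct [u1, u2, u3, u4, w1, w2, w3, w4]" by (rule squareD(5)[OF sq])
  have n: "\<not> E w2 u4" "\<not> E w4 u2" using N(2)[of w4] N(4)[of w2] d sym by auto
  have n': "\<not> E w4 w3" "\<not> E w4 w2" using c sym by blast+
  show False
  proof (rule star_suppress[of u1 u2 u4 w1 u3 w2 u3 w4])
    show "E u2 w \<longleftrightarrow> w = u1 \<or> w = u3 \<or> w = w2" for w using N(2) by blast
    show "E u4 w \<longleftrightarrow> w = u1 \<or> w = u3 \<or> w = w4" for w using N(4) by blast
    show "w = u2" if "E u3 w" "E w2 w" for w using N(3)[of w] that n c by blast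
    show "w = u4" if "E u3 w" "E w4 w" for w using N(3)[of w] that n n' by blast
    show "\<not> E q r" if "E u2 p" "E u2 q" "E u4 p" "E u4 r" "p \<noteq> u1" "q \<noteq> u1" "r \<noteq> u1" "p \<noteq> q" "p \<noteq> r" for p q r
    proof -
      have "p = u3" using that N(2)[of p] N(4)[of p] d by auto
      hence "q = w2" "r = w4" using that N(2)[of q] N(4)[of r] by auto
      thus ?thesis using c by blast
    qed
  qed (use N(1) d in auto)
qed

text \<open>The hypotheses on the \<open>w\<^sub>i\<close> describe the Wagner graph. Delete \<open>u\<^sub>1\<close> and \<open>w\<^sub>3\<close>; as the five-cycle
  \<open>w\<^sub>2u\<^sub>2u\<^sub>3u\<^sub>4w\<^sub>4\<close> is balanced, its path through the \<open>u\<^sub>i\<close> is redundant.\<close>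

lemma crossed_pentagon:
  assumes sq: "square u1 u2 u3 u4 w1 w2 w3 w4" and w: "E w1 w3" "E w2 w4"
    and bal: "s w2 w4 = (((s u2 w2 \<noteq> s u2 u3) \<noteq> s u3 u4) \<noteq> s u4 w4)"
  shows False
proof -
  note N = squareD(1-4)[OF sq] and e = square_edges[OF sq]
  have d: "distinct [u1, u2, u3, u4, w1, w2, w3, w4]" by (rule squareD(5)[OF sq])
  obtain x where Nw1: "\<And>w. E w1 w \<longleftrightarrow> w = u1 \<or> w = w3 \<or> w = x"
    using nbr2[OF e(13) w(1)] d by auto
  have n: "\<not> E w2 u3" "\<not> E w2 u4" using N(3)[of w2] N(4)[of w2] d sym by auto
  \<comment> \<open>Suppressing \<open>u2\<close> and \<open>u3\<close> collapses the path to an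
    edge \<open>w2u4\<close>. By balance \<open>u4\<close> is then the apex of a balanced triangle
    over \<open>w2w4\<close>, so it drops out and no new edge survives.\<close>
  let ?E1 = "add_edge w2 u3 E" and ?s1 = "set_sign w2 u3 (s u2 w2 \<noteq> s u2 u3) s"
  let ?E2 = "add_edge w2 u4 ?E1" and ?s2 = "set_sign w2 u4 (?s1 u3 w2 \<noteq> ?s1 u3 u4) ?s1"
  let ?W = "V - {u1} - {w3} - {w1}"
  have Weq: "V - {u1, w3, w1, u2, u3, u4} = ?W - {u2} - {u3} - {u4}" by blast
  show False
  proof (rule reduce[where X = "{u1, w3, w1, u2, u3, u4}" and d = 2, OF _ _ restrict_tf restrict_cf sgn])
    fix k assume "frust_le k E s (V - {u1, w3, w1, u2, u3, u4})"
    hence "frust_le k ?E2 ?s2 (?W - {u2} - {u3} - {u4})"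
      unfolding Weq by (rule frust_le_mono) (auto simp: add_edge_def set_sign_def)
    hence "frust_le k ?E2 ?s2 (?W - {u2} - {u3})"
    proof (rule frust_le_drop[where y = w2 and z = w4])
      show "\<not> ?E2 u4 u4" using d irr by (auto simp: add_edge_def)
      show "v = w2 \<or> v = w4" if "v \<in> ?W - {u2} - {u3}" "?E2 u4 v" for v
        using that N(4) d by (auto simp: add_edge_def)
      show "?E2 w2 w4" using w by (simp add: add_edge_def)
      show "?s2 w2 w4 = (?s2 u4 w2 \<noteq> ?s2 u4 w4)"
        using d bal sgn_sym[of u3 w2] by (auto simp: set_sign_def)
    qed (use d in \<open>auto intro!: symp_add_edge symp_set_sign symE sgn\<close>)
    hence "frust_le k ?E1 ?s1 (?W - {u2})"
      by (rule frust_le_suppress[OF _ symp_add_edge[OF symE] symp_set_sign[OF sgn]])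
        (use d n irr N(3) in \<open>auto simp: add_edge_def\<close>)
    hence "frust_le k E s ?W"
      by (rule frust_le_suppress[OF _ symE sgn irr]) (use d n N(2) in auto)
    hence "frust_le k E s (V - {u1} - {w3})"
      by (rule step_peel[where p = x]) (use Nw1 in auto)
    hence "frust_le (Suc k) E s (V - {u1})" by (rule step_delete) (use e d in auto)
    thus "frust_le (k + 2) E s V" using step_delete e by simp
  next
    show "card (V - {u1, w3, w1, u2, u3, u4}) div 3 + 2 \<le> card V div 3"
      by (rule div3) (use e d in auto)
  qed (use e in auto)
qed

text \<open>Delete \<open>w\<^sub>1\<close> and \<open>w\<^sub>2\<close>. As the four-cycle is balanced, its path through \<open>u\<^sub>1\<close> and \<open>u\<^sub>2\<close> is
  redundant, and what is left of it is a path from \<open>w\<^sub>3\<close> to \<open>w\<^sub>4\<close>.\<close>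

lemma crossed_join:
  assumes sq: "square u1 u2 u3 u4 w1 w2 w3 w4" and w: "E w1 w3" "E w2 w4"
    and bal: "(s u1 u4 \<noteq> s u1 u2) = (s u2 u3 \<noteq> s u3 u4)"
  shows "E w3 w4 \<or> (\<exists>y. y \<notin> {w1, w2, u1, u2, u3, u4} \<and> E w3 y \<and> E w4 y)"
proof (rule ccontr)
  assume c: "\<not> ?thesis"
  note N = squareD(1-4)[OF sq] and e = square_edges[OF sq]
  have d: "distinct [u1, u2, u3, u4, w1, w2, w3, w4]" by (rule squareD(5)[OF sq])
  obtain x where Nw3: "\<And>w. E w3 w \<longleftrightarrow> w = u3 \<or> w = w1 \<or> w = x"
    using nbr2[OF e(15) sym[OF w(1)]] d by auto
  have n: "\<not> E u4 u2" using N(4)[of u2] d by auto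
  let ?E1 = "add_edge u4 u2 E" and ?s1 = "set_sign u4 u2 (s u1 u4 \<noteq> s u1 u2) s"
  let ?X = "{w1, w2, u1, u2, u3, u4}" and ?W = "V - {w1} - {w2} - {u1} - {u2}"
  have "\<exists>t. symp t \<and> (\<forall>k. frust_le k (add_edge w3 w4 E) t (?W - set [u3, u4]) \<longrightarrow> frust_le k E s ?W)"
    by (rule frust_le_path[OF symE sgn]) (use d e irr N(3,4) c in auto)
  then obtain t where t: "symp t" "\<And>k. frust_le k (add_edge w3 w4 E) t (?W - set [u3, u4]) \<Longrightarrow> frust_le k E s ?W"
    by blast
  have Weq: "V - ?X = ?W - set [u3, u4]" by auto
  show False
  \<comment> \<open>\<open>w3\<close> has lost \<open>u3\<close> and \<open>w1\<close>, so beside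
    the new edge it keeps only \<open>x\<close>: it is its own degree-two witness.\<close>
  proof (rule reduce_add[where X = ?X and d = 2 and y = w3 and z = w4 and y' = u3 and z' = u4
        and u = w3 and p = x and q = w4 and s' = t])
    show False if "w \<in> V - ?X" "E w3 w" "E w4 w" for w using c that by blast
    show "w = x \<or> w = w4" if "w \<in> V - ?X" "add_edge w3 w4 E w3 w" for w
      using that Nw3 d by (auto simp: add_edge_def)
    fix k assume "frust_le k (add_edge w3 w4 E) t (V - ?X)"
    hence "frust_le k E s ?W" unfolding Weq by (rule t(2))
    hence "frust_le k ?E1 ?s1 ?W"
      by (rule frust_le_mono) (auto simp: add_edge_def set_sign_def)
    hence "frust_le k ?E1 ?s1 (V - {w1} - {w2} - {u1})"
    proof (rule frust_le_drop[where y = u4 and z = u3])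
      show "\<not> ?E1 u2 u2" using d irr by (auto simp: add_edge_def)
      show "v = u4 \<or> v = u3" if "v \<in> V - {w1} - {w2} - {u1}" "?E1 u2 v" for v
        using that N(2) d by (auto simp: add_edge_def)
      show "?E1 u4 u3" using e by (simp add: add_edge_def)
      show "?s1 u4 u3 = (?s1 u2 u4 \<noteq> ?s1 u2 u3)"
        using d bal sgn_sym[of u4 u3] by (auto simp: set_sign_def)
    qed (use d in \<open>auto intro!: symp_add_edge symp_set_sign symE sgn\<close>)
    hence "frust_le k E s (V - {w1} - {w2})"
      by (rule frust_le_suppress[OF _ symE sgn irr]) (use d n N(1) in auto)
    hence "frust_le (Suc k) E s (V - {w1})" by (rule step_delete) (use e d in auto)
    thus "frust_le (k + 2) E s V" using step_delete e by simp
  qed (use e d t(1) in auto)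
qed

text \<open>The five-cycles on \<open>w2w4\<close> through \<open>u3\<close> and through
  \<open>u1\<close> are both unbalanced and sum to the square, which is therefore balanced.
  \<open>crossed_join\<close> for the square and its quarter turn then forces the last neighbour of
  \<open>w4\<close> to close a triangle on \<open>w1w3\<close>.\<close>

lemma not_crossed:
  assumes sq: "square u1 u2 u3 u4 w1 w2 w3 w4" and w: "E w1 w3" "E w2 w4"
  shows False
proof -
  note N = squareD(1-4)[OF sq] and e = square_edges[OF sq]
  have d: "distinct [u1, u2, u3, u4, w1, w2, w3, w4]" by (rule squareD(5)[OF sq])
  note sq2 = square_rot[OF sq] and sq3 = square_rot[OF square_rot[OF sq]]
  have "s w2 w4 \<noteq> (((s u2 w2 \<noteq> s u2 u3) \<noteq> s u3 u4) \<noteq> s u4 w4)"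
    using crossed_pentagon[OF sq w] by blast
  moreover have "s w4 w2 \<noteq> (((s u4 w4 \<noteq> s u4 u1) \<noteq> s u1 u2) \<noteq> s u2 w2)"
    using crossed_pentagon[OF sq3] w sym by blast
  ultimately have bal: "(s u1 u4 \<noteq> s u1 u2) = (s u2 u3 \<noteq> s u3 u4)"
    using sgn_sym[of w2 w4] sgn_sym[of u1 u4] by argo
  hence bal': "(s u2 u1 \<noteq> s u2 u3) = (s u3 u4 \<noteq> s u4 u1)"
    using sgn_sym[of u2 u1] sgn_sym[of u1 u4] by argo
  note J1 = crossed_join[OF sq w bal] and J2 = crossed_join[OF sq2 w(2) sym[OF w(1)] bal']
  obtain x where Nw4: "\<And>w. E w4 w \<longleftrightarrow> w = u4 \<or> w = w2 \<or> w = x"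
    using nbr2[OF e(16) sym[OF w(2)]] d by auto
  have x1: "x = w3 \<or> x \<notin> {w1, w2, u1, u2, u3, u4} \<and> E w3 x"
    using J1
  proof
    assume "E w3 w4"
    thus ?thesis using Nw4[of w3] sym d by auto
  next
    assume "\<exists>y. y \<notin> {w1, w2, u1, u2, u3, u4} \<and> E w3 y \<and> E w4 y"
    thus ?thesis using Nw4 by auto
  qed
  have x2: "x = w1 \<or> x \<notin> {w2, w3, u1, u2, u3, u4} \<and> E w1 x"
    using J2
  proof
    assume "E w4 w1"
    thus ?thesis using Nw4[of w1] d by auto
  next
    assume "\<exists>y. y \<notin> {w2, w3, u2, u3, u4, u1} \<and> E w4 y \<and> E w1 y"
    thus ?thesis using Nw4 by auto
  qed
  have "E w3 x" "E w1 x" using x1 x2 d by auto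
  thus False using tri[of w1 w3 x] w sym by blast
qed

text \<open>Any three of the \<open>w\<close>s span an edge but no triangle, which forces a perfect
  matching among the four; the crossing one is excluded.\<close>

lemma square_ladder:
  assumes sq: "square u1 u2 u3 u4 w1 w2 w3 w4"
  shows "E w1 w2 \<and> E w3 w4 \<or> E w2 w3 \<and> E w4 w1"
proof -
  note sq2 = square_rot[OF sq]
  note sq3 = square_rot[OF sq2]
  note sq4 = square_rot[OF sq3]
  have "\<not> (E w1 w3 \<and> E w2 w4)" using not_crossed[OF sq] by blast
  moreover have "E w2 w1 \<longleftrightarrow> E w1 w2" "E w3 w2 \<longleftrightarrow> E w2 w3" "E w4 w3 \<longleftrightarrow> E w3 w4"
    "E w1 w4 \<longleftrightarrow> E w4 w1" "E w3 w1 \<longleftrightarrow> E w1 w3" "E w4 w2 \<longleftrightarrow> E w2 w4" using sym by blast+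
  moreover note square_outer_edge[OF sq] square_outer_edge[OF sq2] square_outer_edge[OF sq3]
    square_outer_edge[OF sq4] tri[of w1 w2 w3] tri[of w2 w3 w4] tri[of w3 w4 w1] tri[of w4 w1 w2]
  ultimately show ?thesis by argo
qed

subsection \<open>Ladders\<close>

text \<open>Five rungs, because the three inner ones are six removable vertices and pay for two
  deletions. Each end vertex keeps one unspecified neighbour.\<close>

definition ladder :: "'a \<Rightarrow> 'a \<Rightarrow> 'a \<Rightarrow> 'a \<Rightarrow> 'a \<Rightarrow> 'a \<Rightarrow> 'a \<Rightarrow> 'a \<Rightarrow> 'a \<Rightarrow> 'a \<Rightarrow> bool" where
  "ladder a0 a1 a2 a3 a4 b0 b1 b2 b3 b4 \<longleftrightarrow>
     (\<forall>w. E a1 w \<longleftrightarrow> w = a0 \<or> w = a2 \<or> w = b1) \<and> (\<forall>w. E a2 w \<longleftrightarrow> w = a1 \<or> w = a3 \<or> w = b2) \<and>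
     (\<forall>w. E a3 w \<longleftrightarrow> w = a2 \<or> w = a4 \<or> w = b3) \<and>
     (\<forall>w. E b1 w \<longleftrightarrow> w = b0 \<or> w = b2 \<or> w = a1) \<and> (\<forall>w. E b2 w \<longleftrightarrow> w = b1 \<or> w = b3 \<or> w = a2) \<and>
     (\<forall>w. E b3 w \<longleftrightarrow> w = b2 \<or> w = b4 \<or> w = a3) \<and> E a0 b0 \<and> E a4 b4 \<and>
     distinct [a0, a1, a2, a3, a4, b0, b1, b2, b3, b4]"

lemma ladder_swap:
  "ladder a0 a1 a2 a3 a4 b0 b1 b2 b3 b4 \<Longrightarrow> ladder b0 b1 b2 b3 b4 a0 a1 a2 a3 a4"
  unfolding ladder_def using sym by (elim conjE) (intro conjI; (assumption | force))

lemma ladderD: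
  assumes "ladder a0 a1 a2 a3 a4 b0 b1 b2 b3 b4"
  shows "E a1 w \<longleftrightarrow> w = a0 \<or> w = a2 \<or> w = b1" "E a2 w \<longleftrightarrow> w = a1 \<or> w = a3 \<or> w = b2"
    "E a3 w \<longleftrightarrow> w = a2 \<or> w = a4 \<or> w = b3" "E b1 w \<longleftrightarrow> w = b0 \<or> w = b2 \<or> w = a1"
    "E b2 w \<longleftrightarrow> w = b1 \<or> w = b3 \<or> w = a2" "E b3 w \<longleftrightarrow> w = b2 \<or> w = b4 \<or> w = a3"
    "E a0 b0" "E a4 b4" "distinct [a0, a1, a2, a3, a4, b0, b1, b2, b3, b4]"
  using assms unfolding ladder_def by blast+

lemma ladder_edges:
  assumes "ladder a0 a1 a2 a3 a4 b0 b1 b2 b3 b4"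
  shows "E a0 a1" "E b0 b1" "E a4 a3" "E b4 b3" "E b0 a0" "E b4 a4"
    "a0 \<in> V" "a1 \<in> V" "a2 \<in> V" "a3 \<in> V" "a4 \<in> V" "b0 \<in> V" "b1 \<in> V" "b2 \<in> V" "b3 \<in> V" "b4 \<in> V"
proof -
  note N = ladderD[OF assms]
  have "E a1 a0" "E b1 b0" "E a3 a4" "E b3 b4" by (simp_all add: N)
  from this[THEN sym] show e: "E a0 a1" "E b0 b1" "E a4 a3" "E b4 b3" .
  show "E b0 a0" "E b4 a4" using N(7,8)[THEN sym] .
  have "E a1 b1" "E a2 b2" "E a3 b3" "E b1 a1" "E b2 a2" "E b3 a3" by (simp_all add: N)
  from this[THEN inV] e[THEN inV]
  show "a0 \<in> V" "a1 \<in> V" "a2 \<in> V" "a3 \<in> V" "a4 \<in> V" "b0 \<in> V" "b1 \<in> V" "b2 \<in> V" "b3 \<in> V" "b4 \<in> V" by blast+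
qed

text \<open>Such an edge fixes the last neighbour of \<open>a4\<close> or \<open>b4\<close>;
  deleting \<open>b0\<close>, \<open>a1\<close>, \<open>a3\<close> then unravels six more vertices,
  nine for three.\<close>

lemma ladder_ends_nonadj:
  assumes lad: "ladder a0 a1 a2 a3 a4 b0 b1 b2 b3 b4"
  shows "\<not> E b0 a4" "\<not> E b0 b4"
proof -
  note N = ladderD(1-6)[OF lad] and e = ladder_edges[OF lad]
  have d: "distinct [a0, a1, a2, a3, a4, b0, b1, b2, b3, b4]" by (rule ladderD(9)[OF lad])
  obtain p where Na0: "\<And>w. E a0 w \<longleftrightarrow> w = a1 \<or> w = b0 \<or> w = p"
    using nbr2[OF e(1) ladderD(7)[OF lad]] d by auto
  show "\<not> E b0 a4"
  proof
    assume "E b0 a4"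
    hence Na4: "E a4 w \<longleftrightarrow> w = a3 \<or> w = b4 \<or> w = b0" for w
      using nbrs3[OF e(3) ladderD(8)[OF lad] sym] d by auto
    show False
    proof (rule strip[where D = "{b0, a1, a3}" and
          xs = "[(a2, b2), (b1, b2), (b2, b3), (b3, b4), (a4, b4), (a0, p)]"])
      show "peels (V - {b0, a1, a3}) [(a2, b2), (b1, b2), (b2, b3), (b3, b4), (a4, b4), (a0, p)]"
        using N Na0 Na4 by auto
    qed (use e d in auto)
  qed
  show "\<not> E b0 b4"
  proof
    assume "E b0 b4"
    hence Nb4: "E b4 w \<longleftrightarrow> w = b3 \<or> w = a4 \<or> w = b0" for w
      using nbrs3[OF e(4,6) sym] d by auto
    show False
    proof (rule strip[where D = "{b0, a1, a3}" and
          xs = "[(a2, b2), (b1, b2), (b2, b3), (b3, b4), (b4, a4), (a0, p)]"])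
      show "peels (V - {b0, a1, a3}) [(a2, b2), (b1, b2), (b2, b3), (b3, b4), (b4, a4), (a0, p)]"
        using N Na0 Nb4 by auto
    qed (use e d in auto)
  qed
qed

text \<open>Deleting \<open>a\<^sub>1, a\<^sub>3\<close> leaves a path from \<open>b\<^sub>0\<close> to \<open>b\<^sub>4\<close>, deleting \<open>a\<^sub>1, b\<^sub>3\<close> one from \<open>b\<^sub>0\<close> to \<open>a\<^sub>4\<close>;
  suppressing it is impossible only if it creates a triangle.\<close>

lemma ladder_join_straight:
  assumes lad: "ladder a0 a1 a2 a3 a4 b0 b1 b2 b3 b4"
  shows "\<exists>y. y \<notin> {a1, a2, a3, b1, b2, b3} \<and> E b0 y \<and> E b4 y"
proof (rule ccontr)
  assume c: "\<not> ?thesis"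
  note N = ladderD(1-6)[OF lad] and e = ladder_edges[OF lad]
  have d: "distinct [a0, a1, a2, a3, a4, b0, b1, b2, b3, b4]" by (rule ladderD(9)[OF lad])
  obtain p where Na0: "\<And>w. E a0 w \<longleftrightarrow> w = a1 \<or> w = b0 \<or> w = p"
    using nbr2[OF e(1) ladderD(7)[OF lad]] d by auto
  have n: "\<not> E b0 b4" by (rule ladder_ends_nonadj(2)[OF lad])
  let ?X = "{a1, a2, a3, b1, b2, b3}" and ?W = "V - {a1} - {a3} - {a2}"
  have "\<exists>t. symp t \<and> (\<forall>k. frust_le k (add_edge b0 b4 E) t (?W - set [b1, b2, b3]) \<longrightarrow> frust_le k E s ?W)"
    by (rule frust_le_path[OF symE sgn]) (use d e irr N n in auto)
  then obtain t where t: "symp t" "\<And>k. frust_le k (add_edge b0 b4 E) t (?W - set [b1, b2, b3]) \<Longrightarrow> frust_le k E s ?W"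
    by blast
  have Weq: "V - ?X = ?W - set [b1, b2, b3]" by auto
  show False
  \<comment> \<open>The degree-two witness is \<open>a0\<close>: it has lost \<open>a1\<close>, is
    no end of the new edge, and is adjacent to the end \<open>b0\<close>.\<close>
  proof (rule reduce_add[where X = ?X and d = 2 and y = b0 and z = b4 and y' = b1 and z' = b3
        and u = a0 and p = b0 and q = p and s' = t])
    show False if "w \<in> V - ?X" "E b0 w" "E b4 w" for w using c that by blast
    show "w = b0 \<or> w = p" if "w \<in> V - ?X" "add_edge b0 b4 E a0 w" for w
      using that Na0 d by (auto simp: add_edge_def)
    fix k assume "frust_le k (add_edge b0 b4 E) t (V - ?X)"
    hence "frust_le k E s ?W" unfolding Weq by (rule t(2))
    hence "frust_le k E s (V - {a1} - {a3})" by (rule step_peel[where p = b2]) (use N(2) in auto)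
    hence "frust_le (Suc k) E s (V - {a1})" by (rule step_delete) (use e d in auto)
    thus "frust_le (k + 2) E s V" using step_delete e by simp
  qed (use e d t(1) in auto)
qed

lemma ladder_join_diagonal:
  assumes lad: "ladder a0 a1 a2 a3 a4 b0 b1 b2 b3 b4"
  shows "\<exists>y. y \<notin> {a1, a2, a3, b1, b2, b3} \<and> E b0 y \<and> E a4 y"
proof (rule ccontr)
  assume c: "\<not> ?thesis"
  note N = ladderD(1-6)[OF lad] and e = ladder_edges[OF lad]
  have d: "distinct [a0, a1, a2, a3, a4, b0, b1, b2, b3, b4]" by (rule ladderD(9)[OF lad])
  obtain p where Na0: "\<And>w. E a0 w \<longleftrightarrow> w = a1 \<or> w = b0 \<or> w = p"
    using nbr2[OF e(1) ladderD(7)[OF lad]] d by auto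
  have n: "\<not> E b0 a4" by (rule ladder_ends_nonadj(1)[OF lad])
  let ?X = "{a1, a2, a3, b1, b2, b3}" and ?W = "V - {a1} - {b3}"
  have "\<exists>t. symp t \<and> (\<forall>k. frust_le k (add_edge b0 a4 E) t (?W - set [b1, b2, a2, a3]) \<longrightarrow> frust_le k E s ?W)"
    by (rule frust_le_path[OF symE sgn]) (use d e irr N n in auto)
  then obtain t where t: "symp t" "\<And>k. frust_le k (add_edge b0 a4 E) t (?W - set [b1, b2, a2, a3]) \<Longrightarrow> frust_le k E s ?W"
    by blast
  have Weq: "V - ?X = ?W - set [b1, b2, a2, a3]" by auto
  show False
  proof (rule reduce_add[where X = ?X and d = 2 and y = b0 and z = a4 and y' = b1 and z' = a3
        and u = a0 and p = b0 and q = p and s' = t])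
    show False if "w \<in> V - ?X" "E b0 w" "E a4 w" for w using c that by blast
    show "w = b0 \<or> w = p" if "w \<in> V - ?X" "add_edge b0 a4 E a0 w" for w
      using that Na0 d by (auto simp: add_edge_def)
    fix k assume "frust_le k (add_edge b0 a4 E) t (V - ?X)"
    hence "frust_le k E s ?W" unfolding Weq by (rule t(2))
    hence "frust_le (Suc k) E s (V - {a1})" by (rule step_delete) (use e d in auto)
    thus "frust_le (k + 2) E s V" using step_delete e by simp
  qed (use e d t(1) in auto)
qed

text \<open>Both joins yield a neighbour of \<open>b0\<close> other than \<open>b1\<close> and
  \<open>a0\<close>, hence the same vertex, and it closes a triangle on the rung
  \<open>a4b4\<close>.\<close>

lemma no_ladder: "\<not> ladder a0 a1 a2 a3 a4 b0 b1 b2 b3 b4"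
proof
  assume lad: "ladder a0 a1 a2 a3 a4 b0 b1 b2 b3 b4"
  note e = ladder_edges[OF lad]
  have d: "distinct [a0, a1, a2, a3, a4, b0, b1, b2, b3, b4]" by (rule ladderD(9)[OF lad])
  have n: "\<not> E a0 b4" "\<not> E a0 a4" using ladder_ends_nonadj[OF ladder_swap[OF lad]] .
  obtain q where Nb0: "\<And>w. E b0 w \<longleftrightarrow> w = b1 \<or> w = a0 \<or> w = q"
    using nbr2[OF e(2,5)] d by auto
  obtain y where y: "y \<notin> {a1, a2, a3, b1, b2, b3}" "E b0 y" "E b4 y"
    using ladder_join_straight[OF lad] by blast
  obtain y' where y': "y' \<notin> {a1, a2, a3, b1, b2, b3}" "E b0 y'" "E a4 y'"
    using ladder_join_diagonal[OF lad] by blast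
  have "y = q" using y n Nb0[of y] sym by auto
  moreover have "y' = q" using y' n Nb0[of y'] sym by auto
  ultimately show False using tri[of a4 b4 q] ladderD(8)[OF lad] y(3) y'(3) sym by blast
qed

text \<open>Four rungs are present, and \<open>square_ladder\<close> at the square
  \<open>w1 w2 u2 u1\<close> supplies the fifth, \<open>ab\<close>. If it met \<open>w3w4\<close>,
  the straight closure would be a cube and the twisted one the crossed case.\<close>

lemma not_parallel:
  assumes sq: "square u1 u2 u3 u4 w1 w2 w3 w4" and w: "E w1 w2" "E w3 w4"
  shows False
proof -
  note N = squareD(1-4)[OF sq] and e = square_edges[OF sq]
  have d: "distinct [u1, u2, u3, u4, w1, w2, w3, w4]" by (rule squareD(5)[OF sq])
  obtain a where a: "a \<noteq> w2" "a \<noteq> u1" and Nw1: "\<And>w. E w1 w \<longleftrightarrow> w = w2 \<or> w = u1 \<or> w = a"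
    using nbr2[OF w(1) e(13)] d by auto
  obtain b where b: "b \<noteq> u2" "b \<noteq> w1" and Nw2: "\<And>w. E w2 w \<longleftrightarrow> w = u2 \<or> w = w1 \<or> w = b"
    using nbr2[OF e(14) sym[OF w(1)]] d by auto
  have ab: "E a w1" "E b w2" using Nw1[of a] Nw2[of b] sym by simp_all
  have "\<not> E u2 w1" "\<not> E u3 w1" "\<not> E u4 w1" "\<not> E u1 w2" "\<not> E u3 w2" "\<not> E u4 w2"
    using d by (auto simp: N)
  hence au: "a \<notin> {u1, u2, u3, u4}" "b \<notin> {u1, u2, u3, u4}"
    using ab a b by blast+
  have aw: "a \<noteq> w1" "b \<noteq> w2" using ab irr by blast+
  have cube: "\<not> (E w2 w3 \<and> E w4 w1)"
  proof
    assume "E w2 w3 \<and> E w4 w1"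
    hence "cube_on E {u1, u2, u3, u4, w1, w2, w3, w4}"
      unfolding cube_on_def using w e d
      by (rule_tac x = u1 in exI, rule_tac x = u2 in exI, rule_tac x = u3 in exI,
          rule_tac x = u4 in exI, rule_tac x = w1 in exI, rule_tac x = w2 in exI,
          rule_tac x = w3 in exI, rule_tac x = w4 in exI) simp
    moreover have "{u1, u2, u3, u4, w1, w2, w3, w4} \<subseteq> V" using e by simp
    ultimately show False using cf unfolding cube_free_def by blast
  qed
  have "a \<noteq> b" using tri[of a w1 w2] ab w sym by blast
  have sq': "square w1 w2 u2 u1 a b u3 u4"
    unfolding square_def using Nw1 Nw2 N d au aw a b \<open>a \<noteq> b\<close> by auto
  have E_ab: "E a b"
  proof (rule ccontr)
    assume "\<not> E a b"
    hence "E b u3" "E u4 a" using square_ladder[OF sq'] by blast+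
    hence "b = w3" "a = w4" using N(3)[of b] N(4)[of a] sym au by auto
    thus False using cube ab sym by blast
  qed
  obtain c where Nw3: "\<And>w. E w3 w \<longleftrightarrow> w = u3 \<or> w = w4 \<or> w = c"
    using nbr2[OF e(15) w(2)] d by auto
  obtain c' where Nw4: "\<And>w. E w4 w \<longleftrightarrow> w = u4 \<or> w = w3 \<or> w = c'"
    using nbr2[OF e(16) sym[OF w(2)]] d by auto
  have nc: "\<not> (E w1 w3 \<and> E w2 w4)" using not_crossed[OF sq] by blast
  have "a \<noteq> w4"
  proof
    assume "a = w4"
    hence "c' = w1" "b = w3" using Nw4[of w1] Nw4[of b] E_ab ab au b d by auto
    thus False using cube \<open>a = w4\<close> ab sym by blast
  qed
  moreover have "a \<noteq> w3"
  proof
    assume "a = w3"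
    hence "c = w1" "b = w4" using Nw3[of w1] Nw3[of b] E_ab ab au b d by auto
    thus False using nc \<open>a = w3\<close> ab sym by blast
  qed
  moreover have "b \<noteq> w3"
  proof
    assume "b = w3"
    hence "c = w2" "a = w4" using Nw3[of w2] Nw3[of a] E_ab[THEN sym] ab au a d by auto
    thus False using \<open>a \<noteq> w4\<close> by blast
  qed
  moreover have "b \<noteq> w4"
  proof
    assume "b = w4"
    hence "c' = w2" "a = w3" using Nw4[of w2] Nw4[of a] E_ab[THEN sym] ab au a d by auto
    thus False using \<open>a \<noteq> w3\<close> by blast
  qed
  ultimately have "ladder a w1 u1 u4 w4 b w2 u2 u3 w3"
    unfolding ladder_def using Nw1 Nw2 N d au aw a b \<open>a \<noteq> b\<close> E_ab sym[OF w(2)] by auto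
  thus False using no_ladder by blast
qed

lemma no_square:
  assumes "E u1 u2" "E u2 u3" "E u3 u4" "E u4 u1" "u1 \<noteq> u3" "u2 \<noteq> u4"
  shows False
proof -
  obtain w1 w2 w3 w4 where sq: "square u1 u2 u3 u4 w1 w2 w3 w4" by (rule square_ex[OF assms])
  show False
    using square_ladder[OF sq] not_parallel[OF sq] not_parallel[OF square_rot[OF sq]] sym by blast
qed

text \<open>Without four-cycles \<open>star_suppress\<close> applies at any vertex, since every
  violation of its side conditions contains one.\<close>

lemma contradiction: False
proof -
  have "V \<noteq> {}"
  proof
    assume "V = {}"
    hence "frust_le (card V div 3) E s V"
      unfolding frust_le_def balanced_by_def by (intro exI[of _ "{}"]) simp
    thus False using counter by simp
  qed
  then obtain v where "v \<in> V" by blast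
  obtain x y z where d: "x \<noteq> y" "x \<noteq> z" "y \<noteq> z" and Nv: "\<And>w. E v w \<longleftrightarrow> w = x \<or> w = y \<or> w = z"
    using not_low_nbr0[OF \<open>v \<in> V\<close> no_low] by blast
  have v: "E v x" "E v y" "E x v" "E y v" using Nv[of x] Nv[of y] sym by simp_all
  obtain x1 x2 where x: "x1 \<noteq> v" "x2 \<noteq> v" "x1 \<noteq> x2" and Nx: "\<And>w. E x w \<longleftrightarrow> w = v \<or> w = x1 \<or> w = x2"
    using not_low_nbr1[OF no_low v(3)] by blast
  obtain y1 y2 where y: "y1 \<noteq> v" "y2 \<noteq> v" "y1 \<noteq> y2" and Ny: "\<And>w. E y w \<longleftrightarrow> w = v \<or> w = y1 \<or> w = y2"
    using not_low_nbr1[OF no_low v(4)] by blast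
  have xe: "E x x1" "E x2 x" "E y y1" "E y2 y" 
    using Nx[of x1] Nx[of x2] Ny[of y1] Ny[of y2] sym by simp_all
  show False
  proof (rule star_suppress[OF Nv Nx Ny d x y])
    show "w = x" if "E x1 w" "E x2 w" for w
      using no_square[of x x1 w x2] that xe x sym by blast
    show "w = y" if "E y1 w" "E y2 w" for w
      using no_square[of y y1 w y2] that xe y sym by blast
    show "\<not> E q r" if "E x p" "E y p" "p \<noteq> v" for p q r
      using no_square[of v x p y] that v d sym by blast
  qed
qed

end

theorem frustration_third:
  fixes V :: "'a set"
  assumes "tf_subcubic E V" "cube_free E V" "symp s"
  shows "frust_le (card V div 3) E s V"
  using assms
proof (induction "card V" arbitrary: V E s rule: less_induct)
  case less
  let ?E = "\<lambda>u v. E u v \<and> u \<in> V \<and> v \<in> V"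
  show ?case
  proof (rule ccontr)
    assume "\<not> ?case"
    have "frust_counterexample V ?E s"
    proof
      have "{v\<in>V. ?E u v} = {v\<in>V. E u v}" if "u \<in> V" for u using that by auto
      moreover have "symp ?E" using less.prems(1) unfolding tf_subcubic_def symp_def by blast
      ultimately show "tf_subcubic ?E V"
        unfolding tf_subcubic_def using tf_subcubicD[OF less.prems(1)] by simp blast
      show "cube_free ?E V"
        using less.prems(2) cube_on_mono[of ?E _ E] unfolding cube_free_def by blast
      show "\<not> frust_le (card V div 3) ?E s V"
        using \<open>\<not> ?case\<close> frust_le_mono[of _ ?E s V E s] by blast
      show "frust_le (card V' div 3) E' s' V'" if "card V' < card V" "tf_subcubic E' V'" "cube_free E' V'" "symp s'"
        for V' :: "'a set" and E' s'
        using less.hyps that by blast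
    qed (use less.prems in auto)
    thus False by (rule frust_counterexample.contradiction)
  qed
qed

subsection \<open>Covers and transversals\<close>

lemma simple_graphD:
  assumes "simple_graph G"
  shows "finite (pverts G)" "finite (parcs G)" "pverts G \<noteq> {}" "(u, v) \<in> parcs G \<Longrightarrow> (v, u) \<in> parcs G"
    "(u, u) \<notin> parcs G" "(u, v) \<in> parcs G \<Longrightarrow> u \<in> pverts G" "(u, v) \<in> parcs G \<Longrightarrow> v \<in> pverts G"
proof -
  interpret pair_graph G using assms by (simp add: simple_graph_def)
  show "finite (pverts G)" "finite (parcs G)" by (rule pair_finite_verts pair_finite_arcs)+
  show "pverts G \<noteq> {}" using assms by (simp add: simple_graph_def)
  show "(u, v) \<in> parcs G \<Longrightarrow> (v, u) \<in> parcs G" using arcs_symmetric by blast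
  show "(u, u) \<notin> parcs G" using no_loops' by blast
  show "(u, v) \<in> parcs G \<Longrightarrow> u \<in> pverts G" "(u, v) \<in> parcs G \<Longrightarrow> v \<in> pverts G"
    using in_arcsD1 in_arcsD2 by blast+
qed

lemma pair_graphI:
  assumes "finite (pverts G)" "parcs G \<subseteq> pverts G \<times> pverts G"
    and "\<And>u v. (u, v) \<in> parcs G \<Longrightarrow> (v, u) \<in> parcs G" "\<And>u. (u, u) \<notin> parcs G"
  shows "pair_graph G"
proof
  show "symmetric (with_proj G)" using assms(3) by (auto simp: symmetric_def intro!: symI)
  show "finite (parcs G)" using assms(1,2) finite_subset by blast
  show "\<And>e. e \<in> parcs G \<Longrightarrow> fst e \<noteq> snd e" using assms(4) by (metis prod.collapse)
qed (use assms in auto)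

lemma indep_num_ge:
  assumes "simple_graph H" "indep_set H I"
  shows "card I \<le> indep_num H"
proof -
  have "{card I |I. indep_set H I} \<subseteq> card ` Pow (pverts H)" by (auto simp: indep_set_def)
  hence "finite {card I |I. indep_set H I}"
    using simple_graphD(1)[OF assms(1)] finite_subset by blast
  thus ?thesis unfolding indep_num_def using assms(2) by (intro Max_ge) auto
qed

lemma card_out_nbrs:
  assumes "simple_graph G" "subcubic G" "u \<in> pverts G"
  shows "card {v. (u, v) \<in> parcs G} \<le> 3"
proof -
  have "out_arcs (with_proj G) u = Pair u ` {v. (u, v) \<in> parcs G}"
    by (auto simp: out_arcs_def)
  hence "out_degree (with_proj G) u = card {v. (u, v) \<in> parcs G}"
    unfolding out_degree_def by (simp add: card_image inj_on_def)
  moreover have "out_degree (with_proj G) u \<le> max_degree G"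
    unfolding max_degree_def using assms simple_graphD(1) by (intro Max_ge) auto
  ultimately show ?thesis using assms(2) unfolding subcubic_def by simp
qed

section \<open>Transversals of a cover: greedy extension and the signed case\<close>

locale graph_cover =
  fixes G :: "'a pair_pre_digraph" and L :: "'a \<Rightarrow> 'b set" and H :: "'b pair_pre_digraph"
  assumes sg: "simple_graph G" and cov: "dp_cover G L H"
begin

lemma sgH: "simple_graph H" using cov by (simp add: dp_cover_def)

lemma part_subset: "u \<in> pverts G \<Longrightarrow> L u \<subseteq> pverts H"
  using cov by (auto simp: dp_cover_def)

lemma parts_disjoint: "u \<in> pverts G \<Longrightarrow> v \<in> pverts G \<Longrightarrow> u \<noteq> v \<Longrightarrow> L u \<inter> L v = {}"
  using cov by (simp add: dp_cover_def disjoint_family_on_def)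

lemma finite_part: "u \<in> pverts G \<Longrightarrow> finite (L u)"
  using part_subset simple_graphD(1)[OF sgH] finite_subset by blast

lemma arc_edge_between:
  assumes "a \<in> L u" "b \<in> L v" "(a, b) \<in> parcs H"
  shows "{a, b} \<in> edges_between H (L u) (L v)"
proof -
  have "{a, b} \<in> uedges H" unfolding uedges_def using assms(3) by blast
  thus ?thesis unfolding edges_between_def using assms(1,2) by simp
qed

lemma cross_matching:
  assumes "(u, v) \<in> parcs G" "a \<in> L u" "b \<in> L v" "b' \<in> L v" "(a, b) \<in> parcs H" "(a, b') \<in> parcs H"
  shows "b = b'"
proof -
  have "is_matching (edges_between H (L u) (L v))" using cov assms(1) by (simp add: dp_cover_def)
  hence "{a, b} = {a, b'}"
    using arc_edge_between[OF assms(2,3,5)] arc_edge_between[OF assms(2,4,6)]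
    unfolding is_matching_def by (metis disjoint_iff insertI1)
  thus ?thesis by (auto simp: doubleton_eq_iff)
qed

lemma cross_nonadj:
  assumes "u \<in> pverts G" "v \<in> pverts G" "u \<noteq> v" "(u, v) \<notin> parcs G" "a \<in> L u" "b \<in> L v"
  shows "(a, b) \<notin> parcs H"
proof -
  have "edges_between H (L u) (L v) = {}" using cov assms(1-4) by (simp add: dp_cover_def)
  thus ?thesis using arc_edge_between[OF assms(5,6)] by blast
qed

definition transversal :: "'a set \<Rightarrow> ('a \<Rightarrow> 'b) \<Rightarrow> bool" where
  "transversal W c \<longleftrightarrow> W \<subseteq> pverts G \<and> (\<forall>u\<in>W. c u \<in> L u) \<and> (\<forall>u\<in>W. \<forall>v\<in>W. (c u, c v) \<notin> parcs H)"

lemma transversal_indep: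
  assumes "transversal W c"
  shows "indep_set H (c ` W)" "card (c ` W) = card W"
proof -
  show "indep_set H (c ` W)"
    using assms part_subset unfolding transversal_def indep_set_def by blast
  have "inj_on c W"
    using assms parts_disjoint unfolding transversal_def inj_on_def by (metis IntI empty_iff subsetD)
  thus "card (c ` W) = card W" by (rule card_image)
qed

lemma transversal_indep_num: "transversal W c \<Longrightarrow> card W \<le> indep_num H"
  using transversal_indep indep_num_ge[OF sgH] by metis

text \<open>By the matching condition a coloured neighbour blocks at most one element of
  \<open>L x\<close>, and a non-neighbour blocks none; \<open>f\<close> below is the resulting
  injection.\<close>

lemma transversal_extend:
  assumes c: "transversal W c" and x: "x \<in> pverts G" "x \<notin> W"
    and few: "card {v\<in>W. (x, v) \<in> parcs G} < card (L x)"
  shows "\<exists>c'. transversal (insert x W) c'"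
proof -
  note sy = simple_graphD(4)[OF sg] and syH = simple_graphD(4)[OF sgH]
  let ?N = "{v\<in>W. (x, v) \<in> parcs G}" and ?B = "{b\<in>L x. \<exists>v\<in>W. (b, c v) \<in> parcs H}"
  have finN: "finite ?N" using c simple_graphD(1)[OF sg] finite_subset unfolding transversal_def by fastforce
  have "\<exists>v\<in>?N. (b, c v) \<in> parcs H" if b: "b \<in> ?B" for b
  proof -
    obtain v where v: "v \<in> W" "(b, c v) \<in> parcs H" using b by blast
    have "v \<in> pverts G" "c v \<in> L v" using c v(1) unfolding transversal_def by auto
    hence "(x, v) \<in> parcs G" using cross_nonadj[of x v b "c v"] x v b by blast
    thus ?thesis using v by blast
  qed
  hence "\<forall>b\<in>?B. \<exists>v. v \<in> ?N \<and> (b, c v) \<in> parcs H" by blast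
  from bchoice[OF this] obtain f where f: "\<And>b. b \<in> ?B \<Longrightarrow> f b \<in> ?N \<and> (b, c (f b)) \<in> parcs H" by blast
  have "inj_on f ?B"
  proof
    fix b b' assume b: "b \<in> ?B" "b' \<in> ?B" "f b = f b'"
    have "(c (f b), b) \<in> parcs H" "(c (f b), b') \<in> parcs H" using f[OF b(1)] f[OF b(2)] b(3) syH by auto
    moreover have "c (f b) \<in> L (f b)" using f[OF b(1)] c unfolding transversal_def by blast
    moreover have "(f b, x) \<in> parcs G" using f[OF b(1)] sy by blast
    ultimately show "b = b'" using cross_matching b by blast
  qed
  hence "card ?B \<le> card ?N" using f finN by (intro card_inj_on_le) auto
  hence "card ?B < card (L x)" using few by simp
  moreover have "finite ?B" using finite_part[OF x(1)] by simp
  ultimately have "\<not> L x \<subseteq> ?B" using card_mono[of ?B "L x"] by linarith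
  then obtain b where b: "b \<in> L x" "\<forall>v\<in>W. (b, c v) \<notin> parcs H" by blast
  have "transversal (insert x W) (c(x := b))"
    unfolding transversal_def
  proof (intro conjI ballI)
    fix u v assume uv: "u \<in> insert x W" "v \<in> insert x W"
    have "(b, b) \<notin> parcs H" by (rule simple_graphD(5)[OF sgH])
    moreover have "(c v, b) \<notin> parcs H" if "v \<in> W" for v using b(2) syH that by blast
    ultimately show "((c(x := b)) u, (c(x := b)) v) \<notin> parcs H"
      using uv b x(2) c unfolding transversal_def by auto
  qed (use c b x in \<open>auto simp: transversal_def\<close>)
  thus ?thesis by blast
qed

lemma greedy_transversal:
  assumes deg: "\<And>u. u \<in> pverts G \<Longrightarrow> card {v. (u, v) \<in> parcs G} \<le> d"
    and L: "\<And>u. u \<in> pverts G \<Longrightarrow> d < card (L u)"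
  shows "\<exists>c. transversal (pverts G) c"
proof -
  have "\<exists>c. transversal W c" if "W \<subseteq> pverts G" for W
    using finite_subset[OF that simple_graphD(1)[OF sg]] that
  proof (induction W rule: finite_induct)
    case empty
    thus ?case by (simp add: transversal_def)
  next
    case (insert x W)
    then obtain c where c: "transversal W c" by blast
    have "finite {v. (x, v) \<in> parcs G}"
      using simple_graphD(1,7)[OF sg] by (metis (mono_tags, lifting) finite_subset mem_Collect_eq subsetI)
    hence "card {v\<in>W. (x, v) \<in> parcs G} \<le> card {v. (x, v) \<in> parcs G}" by (intro card_mono) auto
    thus ?case using deg[of x] L[of x] insert.hyps insert.prems
      by (intro transversal_extend[OF c]) auto
  qed
  thus ?thesis by blast
qed

text \<open>Dropping one vertex of a cubic piece lets its three neighbours be coloured greedily.\<close>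

lemma greedy_three_quarters:
  assumes deg: "\<And>u. u \<in> pverts G \<Longrightarrow> card {v. (u, v) \<in> parcs G} \<le> 3"
    and L: "\<And>u. u \<in> pverts G \<Longrightarrow> card (L u) = 3"
    and "W \<subseteq> pverts G"
  shows "\<exists>D c. D \<subseteq> W \<and> 4 * card D \<le> card W \<and> transversal (W - D) c"
  using assms(3)
proof (induction "card W" arbitrary: W rule: less_induct)
  case less
  have fin: "finite W" using finite_subset[OF less.prems simple_graphD(1)[OF sg]] .
  have finN: "finite {v. (u, v) \<in> parcs G}" for u
    using simple_graphD(1,7)[OF sg] by (metis (mono_tags, lifting) finite_subset mem_Collect_eq subsetI)
  consider "W = {}" | x where "x \<in> W" "card {v\<in>W. (x, v) \<in> parcs G} \<le> 2"
    | v where "v \<in> W" "\<And>x. x \<in> W \<Longrightarrow> \<not> card {v\<in>W. (x, v) \<in> parcs G} \<le> 2" by blast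
  thus ?case
  proof cases
    case 1
    thus ?thesis by (intro exI[of _ "{}"]) (simp add: transversal_def)
  next
    case 2
    \<comment> \<open>A vertex with at most two neighbours in \<open>W\<close> is set aside and
      coloured last, at no cost.\<close>
    have "card (W - {x}) < card W" using 2 fin by (meson card_Diff1_less)
    then obtain D c where D: "D \<subseteq> W - {x}" "4 * card D \<le> card (W - {x})" "transversal (W - {x} - D) c"
      using less by blast
    have "card {v\<in>W - {x} - D. (x, v) \<in> parcs G} \<le> card {v\<in>W. (x, v) \<in> parcs G}"
      using fin by (intro card_mono) auto
    hence "\<exists>c. transversal (insert x (W - {x} - D)) c"
      using 2 less.prems L by (intro transversal_extend[OF D(3)]) auto
    moreover have "insert x (W - {x} - D) = W - D" using D(1) 2 by auto
    ultimately have "\<exists>c. transversal (W - D) c" by simp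
    moreover have "card (W - {x}) \<le> card W" using fin by (simp add: card_mono)
    ultimately show ?thesis using D by (meson Diff_subset order_trans)
  next
    case 3
    have "3 \<le> card {u\<in>W. (v, u) \<in> parcs G}" using 3(2)[OF 3(1)] by simp
    then obtain T where T: "T \<subseteq> {u\<in>W. (v, u) \<in> parcs G}" "card T = 3"
      by (rule obtain_subset_with_card_n)
    obtain x y z where xyz: "T = {x, y, z}" "x \<noteq> y" "x \<noteq> z" "y \<noteq> z"
      using T(2) by (auto simp: card_3_iff)
    have nb: "(v, x) \<in> parcs G" "(v, y) \<in> parcs G" "(v, z) \<in> parcs G" "x \<in> W" "y \<in> W" "z \<in> W"
      using T xyz by auto
    have ne: "x \<noteq> v" "y \<noteq> v" "z \<noteq> v" using nb simple_graphD(5)[OF sg] by blast+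
    let ?X = "{v, x, y, z}"
    have cX: "card (W - ?X) + 4 = card W"
    proof -
      have "card ?X = 4" using xyz ne by simp
      moreover have "?X \<subseteq> W" using nb 3 by blast
      ultimately show ?thesis using fin by (metis card_Diff_subset card_mono finite_subset le_add_diff_inverse2)
    qed
    then obtain D c where D: "D \<subseteq> W - ?X" "4 * card D \<le> card (W - ?X)" "transversal (W - ?X - D) c"
      using less.hyps[of "W - ?X"] less.prems by auto
    \<comment> \<open>\<open>v\<close> stays uncoloured and is one of the at most three neighbours
      of \<open>a\<close>, so at most two elements of \<open>L a\<close> are blocked.\<close>
    have ext: "\<exists>c. transversal (insert a A) c"
      if "transversal A c" "A \<subseteq> W - {v}" "a \<in> W" "(v, a) \<in> parcs G" "a \<notin> A" for a A c
    proof (rule transversal_extend[OF that(1)])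
      have "(a, v) \<in> parcs G" using that(4) simple_graphD(4)[OF sg] by blast
      hence "card {u. (a, u) \<in> parcs G} = Suc (card ({u. (a, u) \<in> parcs G} - {v}))"
        using finN by (intro card.remove) auto
      moreover have "card {u\<in>A. (a, u) \<in> parcs G} \<le> card ({u. (a, u) \<in> parcs G} - {v})"
        using that finN by (intro card_mono) auto
      ultimately show "card {u\<in>A. (a, u) \<in> parcs G} < card (L a)"
        using deg[of a] L[of a] that(3) less.prems by auto
    qed (use that less.prems in auto)
    let ?A = "W - ?X - D"
    obtain c1 where c1: "transversal (insert x ?A) c1" using ext[OF D(3)] nb ne by blast
    obtain c2 where c2: "transversal (insert y (insert x ?A)) c2" using ext[OF c1] nb ne xyz by blast
    obtain c3 where c3: "transversal (insert z (insert y (insert x ?A))) c3"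
      using ext[OF c2] nb ne xyz by blast
    have "insert z (insert y (insert x ?A)) = W - insert v D" using nb D(1) ne by auto
    moreover have "card (insert v D) \<le> Suc (card D)" by (rule card_insert_le_m1) simp_all
    ultimately show ?thesis using c3 cX D(1,2) 3(1)
      by (intro exI[of _ "insert v D"] exI[of _ c3]) auto
  qed
qed

text \<open>Label the two vertices of each part; \<open>s u v\<close> holds if equal labels conflict on the edge \<open>uv\<close>,
  and if it fails only unequal labels can conflict.\<close>

lemma two_fold_transversal:
  assumes G: "subcubic G" "triangle_free G" "cube_free (\<lambda>u v. (u, v) \<in> parcs G) (pverts G)"
    and L: "\<And>u. u \<in> pverts G \<Longrightarrow> card (L u) = 2"
  shows "\<exists>D c. D \<subseteq> pverts G \<and> 3 * card D \<le> card (pverts G) \<and> transversal (pverts G - D) c"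
proof -
  let ?V = "pverts G" and ?E = "\<lambda>u v. (u, v) \<in> parcs G"
  note sy = simple_graphD(4)[OF sg] and syH = simple_graphD(4)[OF sgH]
  have "\<exists>p q. L u = {p, q} \<and> p \<noteq> q" if "u \<in> ?V" for u using L[OF that] by (simp add: card_2_iff)
  then obtain p q where pq: "\<And>u. u \<in> ?V \<Longrightarrow> L u = {p u, q u} \<and> p u \<noteq> q u" by metis
  define s where "s u v \<longleftrightarrow> (p u, p v) \<in> parcs H \<or> (q u, q v) \<in> parcs H" for u v
  have "symp s" using syH unfolding s_def symp_def by blast
  moreover have "tf_subcubic ?E ?V"
    unfolding tf_subcubic_def
  proof (intro conjI ballI impI)
    show "finite ?V" by (rule simple_graphD(1)[OF sg])
    show "symp ?E" using sy unfolding symp_def by blast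
    fix u assume u: "u \<in> ?V"
    have "{v \<in> ?V. (u, v) \<in> parcs G} = {v. (u, v) \<in> parcs G}" using simple_graphD(7)[OF sg] by blast
    thus "card {v \<in> ?V. (u, v) \<in> parcs G} \<le> 3" using card_out_nbrs[OF sg G(1) u] by simp
  next
    show "(z, x) \<notin> parcs G" if "(x, y) \<in> parcs G" "(y, z) \<in> parcs G" for x y z
      using G(2) that unfolding triangle_free_def by blast
  qed
  ultimately obtain D c where D: "D \<subseteq> ?V" "card D \<le> card ?V div 3" "balanced_by ?E s (?V - D) c"
    using frustration_third[OF _ G(3)] unfolding frust_le_def by blast
  define f where "f u = (if c u then p u else q u)" for u
  have "transversal (?V - D) f"
    unfolding transversal_def
  proof (intro conjI ballI)
    show "f u \<in> L u" if "u \<in> ?V - D" for u using that pq[of u] by (auto simp: f_def)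
    fix u v assume u: "u \<in> ?V - D" and v: "v \<in> ?V - D"
    have fu: "f u \<in> L u" "f v \<in> L v" using u v pq[of u] pq[of v] by (auto simp: f_def)
    consider "u = v" | "u \<noteq> v" "(u, v) \<notin> parcs G" | "(u, v) \<in> parcs G" by blast
    thus "(f u, f v) \<notin> parcs H"
    proof cases
      case 1 thus ?thesis using simple_graphD(5)[OF sgH] by simp
    next
      case 2 thus ?thesis using cross_nonadj fu u v by blast
    next
      case 3
      have bal: "(c u \<noteq> c v) = s u v" using D(3) u v 3 unfolding balanced_by_def by blast
      have in_L: "p u \<in> L u" "q u \<in> L u" "p v \<in> L v" "q v \<in> L v" and ne: "p u \<noteq> q u" "p v \<noteq> q v"
        using pq u v by auto
      have m: "b = b'" if "a \<in> L u" "b \<in> L v" "b' \<in> L v" "(a, b) \<in> parcs H" "(a, b') \<in> parcs H" for a b b'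
        using cross_matching[OF 3] that by blast
      have m': "a = a'" if "a \<in> L u" "a' \<in> L u" "b \<in> L v" "(a, b) \<in> parcs H" "(a', b) \<in> parcs H" for a a' b
        using cross_matching[OF sy[OF 3] that(3,1,2)] that(4,5) syH by blast
      show ?thesis
      proof
        assume arc: "(f u, f v) \<in> parcs H"
        show False
        proof (cases "s u v")
          case True
          \<comment> \<open>An equal-label conflict exists by \<open>s u v\<close>; it shares an
            endpoint with any unequal-label pair, so the matching forbids a conflict there.\<close>
          hence "f u = p u \<and> f v = q v \<or> f u = q u \<and> f v = p v" using bal by (auto simp: f_def)
          thus False using arc True m m' in_L ne unfolding s_def by metis
        next
          case False
          hence "f u = p u \<and> f v = p v \<or> f u = q u \<and> f v = q v" using bal by (auto simp: f_def)
          thus False using arc False unfolding s_def by auto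
        qed
      qed
    qed
  qed simp
  thus ?thesis using D by (intro exI[of _ D] exI[of _ f]) auto
qed

end

text \<open>The Cartesian product of \<open>H\<close> with the complete graph on \<open>m\<close>
  vertices.\<close>

definition blow_up :: "nat \<Rightarrow> 'b pair_pre_digraph \<Rightarrow> ('b \<times> nat) pair_pre_digraph" where
  "blow_up m H = \<lparr> pverts = pverts H \<times> {..<m},
     parcs = {((x, i), (y, j)) | x i y j. x \<in> pverts H \<and> y \<in> pverts H \<and> i < m \<and> j < m \<and>
       ((x, y) \<in> parcs H \<and> i = j \<or> x = y \<and> i \<noteq> j)} \<rparr>"

text \<open>Parts of size one are essential: they make each \<open>L u \<times> {..<m}\<close> a
  clique. Cross edges stay within one layer, hence form matchings.\<close>

lemma fold_cover_blow_up:
  assumes sg: "simple_graph G" and fc: "fold_cover 1 G L H" and m: "m \<ge> 1"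
  shows "fold_cover m G (\<lambda>u. L u \<times> {..<m}) (blow_up m H)"
proof -
  interpret graph_cover G L H
    using sg fc by unfold_locales (auto simp: fold_cover_def)
  have single: "\<exists>p. L u = {p}" if "u \<in> pverts G" for u
    using fc that by (auto simp: fold_cover_def card_1_singleton_iff)
  have pg: "pair_graph (blow_up m H)"
    using simple_graphD(1,4,5)[OF sgH] by (intro pair_graphI) (auto simp: blow_up_def)
  hence sgB: "simple_graph (blow_up m H)"
    using simple_graphD(3)[OF sgH] m by (auto simp: simple_graph_def blow_up_def lessThan_empty_iff)
  have cross: "\<exists>x y i. x \<in> L u \<and> y \<in> L v \<and> (x, y) \<in> parcs H \<and> e = {(x, i), (y, i)}"
    if u: "u \<in> pverts G" and v: "v \<in> pverts G" and uv: "u \<noteq> v"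
      and e: "e \<in> edges_between (blow_up m H) (L u \<times> {..<m}) (L v \<times> {..<m})" for u v e
  proof -
    obtain a b where ab: "(a, b) \<in> parcs (blow_up m H)" "e = {a, b}"
      using e unfolding edges_between_def uedges_def by blast
    have "a \<in> L u \<times> {..<m} \<and> b \<in> L v \<times> {..<m} \<or> b \<in> L u \<times> {..<m} \<and> a \<in> L v \<times> {..<m}"
      using e ab(2) parts_disjoint[OF u v uv] unfolding edges_between_def by auto
    moreover have "(b, a) \<in> parcs (blow_up m H)" "e = {b, a}"
      using ab simple_graphD(4)[OF sgB] by auto
    ultimately obtain x i y j where xy: "((x, i), (y, j)) \<in> parcs (blow_up m H)" "e = {(x, i), (y, j)}"
      "x \<in> L u" "y \<in> L v"
      using ab by (cases a; cases b) blast
    have "x \<noteq> y" using xy parts_disjoint[OF u v uv] by blast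
    hence "(x, y) \<in> parcs H \<and> i = j" using xy(1) by (simp add: blow_up_def)
    thus ?thesis using xy by blast
  qed
  have "dp_cover G (\<lambda>u. L u \<times> {..<m}) (blow_up m H)"
    unfolding dp_cover_def
  proof (intro conjI ballI allI impI)
    show "simple_graph (blow_up m H)" by fact
    show "(\<Union>u\<in>pverts G. L u \<times> {..<m}) = pverts (blow_up m H)"
      using cov by (auto simp: blow_up_def dp_cover_def)
    show "disjoint_family_on (\<lambda>u. L u \<times> {..<m}) (pverts G)"
      using parts_disjoint by (auto simp: disjoint_family_on_def)
    show "(x, y) \<in> parcs (blow_up m H)"
      if u: "u \<in> pverts G" and "x \<in> L u \<times> {..<m}" "y \<in> L u \<times> {..<m}" "x \<noteq> y" for u x y
      using single[OF u] that part_subset[OF u] by (auto simp: blow_up_def)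
    show "is_matching (edges_between (blow_up m H) (L u \<times> {..<m}) (L v \<times> {..<m}))" if uv: "(u, v) \<in> parcs G" for u v
    proof -
      have mem: "u \<in> pverts G" "v \<in> pverts G" "u \<noteq> v" using uv simple_graphD(5-7)[OF sg] by blast+
      obtain p r where "L u = {p}" "L v = {r}" using single mem by meson
      hence "p \<noteq> r" using parts_disjoint[OF mem] by auto
      have edge: "\<exists>i. e = {(p, i), (r, i)}" if "e \<in> edges_between (blow_up m H) (L u \<times> {..<m}) (L v \<times> {..<m})" for e
        using cross[OF mem that] \<open>L u = {p}\<close> \<open>L v = {r}\<close> by auto
      show ?thesis
        unfolding is_matching_def
      proof (intro ballI impI)
        fix e f assume "e \<in> edges_between (blow_up m H) (L u \<times> {..<m}) (L v \<times> {..<m})"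
          "f \<in> edges_between (blow_up m H) (L u \<times> {..<m}) (L v \<times> {..<m})" "e \<noteq> f"
        moreover from this obtain i j where "e = {(p, i), (r, i)}" "f = {(p, j), (r, j)}"
          using edge by meson
        ultimately show "e \<inter> f = {}" using \<open>p \<noteq> r\<close> by auto
      qed
    qed
    show "edges_between (blow_up m H) (L u \<times> {..<m}) (L v \<times> {..<m}) = {}"
      if "u \<in> pverts G" "v \<in> pverts G" "u \<noteq> v \<and> (u, v) \<notin> parcs G" for u v
      using cross[of u v] cross_nonadj that by blast
  qed
  thus ?thesis using fc by (simp add: fold_cover_def card_cartesian_product)
qed

text \<open>Every layer of \<open>I\<close> is independent in \<open>H\<close>. Applied to a full
  colouring of the blow-up, this gives the bound for \<open>t = 1\<close>.\<close>

lemma indep_num_blow_up: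
  assumes sgH: "simple_graph H" and I: "indep_set (blow_up m H) I"
  shows "card I \<le> m * indep_num H"
proof -
  let ?J = "\<lambda>i. {x. (x, i) \<in> I}"
  have IV: "I \<subseteq> pverts H \<times> {..<m}" using I by (auto simp: indep_set_def blow_up_def)
  have fin: "finite (?J i)" for i
    using IV simple_graphD(1)[OF sgH] by (auto intro: finite_subset[of _ "pverts H"])
  have J: "indep_set H (?J i)" if "i < m" for i
    using I IV that unfolding indep_set_def blow_up_def by fastforce
  have "I = (\<Union>i<m. (\<lambda>x. (x, i)) ` ?J i)" using IV by auto
  hence "card I = card (\<Union>i<m. (\<lambda>x. (x, i)) ` ?J i)" by (rule arg_cong)
  also have "\<dots> \<le> (\<Sum>i<m. card ((\<lambda>x. (x, i)) ` ?J i))" by (rule card_UN_le) simp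
  also have "\<dots> \<le> (\<Sum>i<m. indep_num H)"
  proof (rule sum_mono)
    fix i assume "i \<in> {..<m}"
    have "card ((\<lambda>x. (x, i)) ` ?J i) \<le> card (?J i)" using fin by (rule card_image_le)
    also have "\<dots> \<le> indep_num H" using indep_num_ge[OF sgH J] \<open>i \<in> {..<m}\<close> by simp
    finally show "card ((\<lambda>x. (x, i)) ` ?J i) \<le> indep_num H" .
  qed
  finally show ?thesis by simp
qed

text \<open>Ensures that the \<open>LEAST\<close> in \<open>partial_dp\<close> ranges over a
  nonempty set; the cover is a blow-up of the edgeless one.\<close>

lemma fold_cover_exists:
  assumes sg: "simple_graph G" and m: "m \<ge> 1"
  shows "\<exists>(L :: 'a \<Rightarrow> nat set) H. fold_cover m (G :: 'a pair_pre_digraph) L H"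
proof -
  let ?H = "\<lparr>pverts = pverts G, parcs = {}\<rparr>"
  have "simple_graph ?H"
    unfolding simple_graph_def using simple_graphD(1,3)[OF sg] by (auto intro!: pair_graphI)
  hence "fold_cover 1 G (\<lambda>u. {u}) ?H"
    unfolding fold_cover_def dp_cover_def
    by (auto simp: disjoint_family_on_def is_matching_def edges_between_def uedges_def)
  from fold_cover_transfer_nat[OF fold_cover_blow_up[OF sg this m] sg] show ?thesis by blast
qed

lemma partial_dp_ge:
  assumes "simple_graph G" "t \<ge> 1"
    and "\<And>(L :: 'a \<Rightarrow> nat set) H. fold_cover t (G :: 'a pair_pre_digraph) L H \<Longrightarrow> P (indep_num H)"
  shows "P (partial_dp t G)"
proof -
  have "\<exists>k (L :: 'a \<Rightarrow> nat set) H. fold_cover t G L H \<and> k = indep_num H"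
    using fold_cover_exists[OF assms(1,2)] by blast
  from LeastI_ex[OF this] obtain L :: "'a \<Rightarrow> nat set" and H
    where "fold_cover t G L H" "partial_dp t G = indep_num H"
    unfolding partial_dp_def by blast
  thus ?thesis using assms(3) by simp
qed

subsection \<open>Recognising the cube\<close>

lemma length_three: "length s = 3 \<longleftrightarrow> (\<exists>p q r. s = [p, q, r])"
  by (auto simp: numeral_3_eq_3 length_Suc_conv)

lemma cube_graph_arc:
  "([p, q, r], [p', q', r']) \<in> parcs cube_graph \<longleftrightarrow>
     of_bool (p \<noteq> p') + of_bool (q \<noteq> q') + of_bool (r \<noteq> r') = (1 :: nat)"
proof -
  let ?Q = "\<lambda>i. [p, q, r] ! i \<noteq> [p', q', r'] ! i"
  have "card {i. i < 3 \<and> ?Q i} = card ({..<3} \<inter> {i. ?Q i})"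
    by (rule arg_cong[where f = card]) auto
  also have "\<dots> = (\<Sum>i<3. of_bool (?Q i))" by (simp add: sum_of_bool_eq)
  also have "\<dots> = of_bool (p \<noteq> p') + of_bool (q \<noteq> q') + of_bool (r \<noteq> r')"
    by (simp add: numeral_3_eq_3)
  finally show ?thesis by (simp add: cube_graph_def)
qed

lemma closed_eq_verts:
  assumes sg: "simple_graph G" and con: "Digraph_Component.connected (with_proj G)"
    and K: "K \<subseteq> pverts G" "K \<noteq> {}" and cl: "\<And>u v. u \<in> K \<Longrightarrow> (u, v) \<in> parcs G \<Longrightarrow> v \<in> K"
  shows "K = pverts G"
proof -
  interpret pair_graph G using sg by (simp add: simple_graph_def)
  obtain u where u: "u \<in> K" using K(2) by blast
  have "v \<in> K" if "v \<in> pverts G" for v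
  proof -
    have "u \<rightarrow>\<^sup>*\<^bsub>with_proj (mk_symmetric (with_proj G))\<^esub> v"
      using con u K(1) that unfolding Digraph_Component.connected_def strongly_connected_def by auto
    hence "(u, v) \<in> (parcs (mk_symmetric (with_proj G)))\<^sup>*"
      using reachable_rtranclI by (metis (no_types, lifting) reachable_def rtrancl_on_rtranclI with_proj_simps(3))
    \<comment> \<open>\<open>connected\<close> is strong connectivity of the symmetrised digraph,
      and symmetrising adds no arcs here.\<close>
    moreover have "parcs (mk_symmetric (with_proj G)) \<subseteq> parcs G"
      using simple_graphD(4)[OF sg] by (auto simp: parcs_mk_symmetric)
    ultimately have "(u, v) \<in> (parcs G)\<^sup>*" using rtrancl_mono by blast
    thus ?thesis using u cl by (induction rule: rtrancl_induct) auto
  qed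
  thus ?thesis using K(1) by blast
qed

lemma nbrs_eq_triple:
  assumes "simple_graph G" "subcubic G" "(u, a) \<in> parcs G" "(u, b) \<in> parcs G" "(u, c) \<in> parcs G"
    "a \<noteq> b" "a \<noteq> c" "b \<noteq> c"
  shows "(u, v) \<in> parcs G \<longleftrightarrow> v = a \<or> v = b \<or> v = c"
proof -
  have "finite {v. (u, v) \<in> parcs G}"
    using simple_graphD(7)[OF assms(1)] by (intro finite_subset[OF _ simple_graphD(1)[OF assms(1)]]) auto
  moreover have "card {v. (u, v) \<in> parcs G} \<le> card {a, b, c}"
    using card_out_nbrs[OF assms(1,2) simple_graphD(6)[OF assms(1,3)]] assms(6-8) by simp
  ultimately have "{a, b, c} = {v. (u, v) \<in> parcs G}" using assms(3-5) by (intro card_seteq) auto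
  thus ?thesis by blast
qed

text \<open>A cube saturates the degrees of its vertices, so in a connected subcubic graph it is
  everything. This turns the exclusion of one graph up to isomorphism into
  \<open>cube_free\<close>.\<close>

lemma cube_iso:
  assumes sg: "simple_graph G" and con: "Digraph_Component.connected (with_proj G)"
    and sub: "subcubic G" and K: "K \<subseteq> pverts G" "cube_on (\<lambda>u v. (u, v) \<in> parcs G) K"
  shows "digraph_iso (with_proj G) (with_proj cube_graph)"
proof -
  obtain a1 a2 a3 a4 b1 b2 b3 b4 where d: "distinct [a1, a2, a3, a4, b1, b2, b3, b4]"
    and Kdef: "K = {a1, a2, a3, a4, b1, b2, b3, b4}"
    and e: "(a1, a2) \<in> parcs G" "(a2, a3) \<in> parcs G" "(a3, a4) \<in> parcs G" "(a4, a1) \<in> parcs G"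
      "(b1, b2) \<in> parcs G" "(b2, b3) \<in> parcs G" "(b3, b4) \<in> parcs G" "(b4, b1) \<in> parcs G"
      "(a1, b1) \<in> parcs G" "(a2, b2) \<in> parcs G" "(a3, b3) \<in> parcs G" "(a4, b4) \<in> parcs G"
    using K(2) unfolding cube_on_def by blast
  note e' = e[THEN simple_graphD(4)[OF sg]]
  note N = nbrs_eq_triple[OF sg sub e(1) e'(4) e(9)] nbrs_eq_triple[OF sg sub e(2) e'(1) e(10)]
    nbrs_eq_triple[OF sg sub e(3) e'(2) e(11)] nbrs_eq_triple[OF sg sub e(4) e'(3) e(12)]
    nbrs_eq_triple[OF sg sub e(5) e'(8) e'(9)] nbrs_eq_triple[OF sg sub e(6) e'(5) e'(10)]
    nbrs_eq_triple[OF sg sub e(7) e'(6) e'(11)] nbrs_eq_triple[OF sg sub e(8) e'(7) e'(12)]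
  \<comment> \<open>Gives the simplifier the same inequalities in the other orientation.\<close>
  have d': "distinct (rev [a1, a2, a3, a4, b1, b2, b3, b4])" using d by (simp only: distinct_rev)
  have N1: "(a1, v) \<in> parcs G \<longleftrightarrow> v = a2 \<or> v = a4 \<or> v = b1" "(a2, v) \<in> parcs G \<longleftrightarrow> v = a3 \<or> v = a1 \<or> v = b2"
    "(a3, v) \<in> parcs G \<longleftrightarrow> v = a4 \<or> v = a2 \<or> v = b3" "(a4, v) \<in> parcs G \<longleftrightarrow> v = a1 \<or> v = a3 \<or> v = b4"
    "(b1, v) \<in> parcs G \<longleftrightarrow> v = b2 \<or> v = b4 \<or> v = a1" "(b2, v) \<in> parcs G \<longleftrightarrow> v = b3 \<or> v = b1 \<or> v = a2"
    "(b3, v) \<in> parcs G \<longleftrightarrow> v = b4 \<or> v = b2 \<or> v = a3" "(b4, v) \<in> parcs G \<longleftrightarrow> v = b1 \<or> v = b3 \<or> v = a4" for v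
    by (rule N; use d d' in simp)+
  have KV: "K = pverts G"
  proof (rule closed_eq_verts[OF sg con K(1)])
    show "v \<in> K" if "u \<in> K" "(u, v) \<in> parcs G" for u v
      using that unfolding Kdef by (elim insertE emptyE) (simp_all add: N1, blast+)
  qed (simp add: Kdef)
  \<comment> \<open>The first bit selects the four-cycle; the other two run around it in Gray code
    order 00, 01, 11, 10.\<close>
  define g where "g s = (if s ! 0 then (if s ! 1 then (if s ! 2 then b3 else b4) else (if s ! 2 then b2 else b1))
    else (if s ! 1 then (if s ! 2 then a3 else a4) else (if s ! 2 then a2 else a1)))" for s :: "bool list"
  have arc: "(g s, g s') \<in> parcs G \<longleftrightarrow> (s, s') \<in> parcs cube_graph"
    if len: "length s = 3" "length s' = 3" for s s'
  proof -
    obtain p q r where s: "s = [p, q, r]" using len(1) unfolding length_three by blast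
    obtain p' q' r' where s': "s' = [p', q', r']" using len(2) unfolding length_three by blast
    show ?thesis
      unfolding s s' cube_graph_arc using d d'
      by (cases p; cases q; cases r; cases p'; cases q'; cases r') (simp_all add: g_def N1)
  qed
  have img: "g ` {s. length s = 3} = pverts G"
  proof
    have "g s \<in> K" for s
      by (cases "s ! 0"; cases "s ! 1"; cases "s ! 2") (simp_all add: g_def Kdef)
    thus "g ` {s. length s = 3} \<subseteq> pverts G" using KV by blast
    have g: "g [p, q, r] \<in> g ` {s. length s = 3}" for p q r by simp
    have "K \<subseteq> g ` {s. length s = 3}"
      unfolding Kdef using g[of False False False] g[of False False True] g[of False True True]
        g[of False True False] g[of True False False] g[of True False True] g[of True True True]
        g[of True True False] by (simp add: g_def)
    thus "pverts G \<subseteq> g ` {s. length s = 3}" using KV by blast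
  qed
  have inj: "inj_on g {s. length s = 3}"
  proof (rule inj_onI)
    fix s s' assume len: "s \<in> {s. length s = 3}" "s' \<in> {s. length s = 3}" and eq: "g s = g s'"
    obtain p q r where s: "s = [p, q, r]" using len(1) unfolding mem_Collect_eq length_three by blast
    obtain p' q' r' where s': "s' = [p', q', r']" using len(2) unfolding mem_Collect_eq length_three by blast
    show "s = s'" using eq d d' unfolding s s'
      by (cases p; cases q; cases r; cases p'; cases q'; cases r') (simp_all add: g_def)
  qed
  have cV: "pverts cube_graph = {s. length s = 3}" by (simp add: cube_graph_def)
  have cA: "length s = 3 \<and> length s' = 3" if "(s, s') \<in> parcs cube_graph" for s s'
    using that by (simp add: cube_graph_def)
  have arcs: "map_prod g g ` parcs cube_graph = parcs G"
  proof (intro set_eqI iffI)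
    fix x assume "x \<in> map_prod g g ` parcs cube_graph"
    thus "x \<in> parcs G" using arc cA by auto
  next
    fix x assume x: "x \<in> parcs G"
    obtain u v where uv: "x = (u, v)" by (cases x)
    have "u \<in> g ` {s. length s = 3}" "v \<in> g ` {s. length s = 3}"
      using simple_graphD(6,7)[OF sg] x uv img by blast+
    then obtain s s' where "u = g s" "v = g s'" "length s = 3" "length s' = 3" by blast
    thus "x \<in> map_prod g g ` parcs cube_graph" using arc x uv by (metis map_prod_imageI)
  qed
  have wf: "wf_digraph (with_proj cube_graph)"
    by unfold_locales (use cA cV in auto)
  let ?f = "\<lparr>iso_verts = g, iso_arcs = map_prod g g, iso_head = snd, iso_tail = fst\<rparr>"
  have "inj_on (map_prod g g) (parcs cube_graph)"
    by (rule inj_on_subset[OF map_prod_inj_on[OF inj inj]]) (use cA in auto)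
  hence "pre_digraph.digraph_isomorphism (with_proj cube_graph) ?f"
    unfolding pre_digraph.digraph_isomorphism_def using wf inj by (simp add: cV)
  moreover have "with_proj G = app_iso ?f (with_proj cube_graph)"
    by (simp add: app_iso_def with_proj_def arcs cV img)
  ultimately have "digraph_iso (with_proj cube_graph) (with_proj G)" unfolding digraph_iso_def by blast
  thus ?thesis by (rule digraph_iso_swap[OF wf])
qed

subsection \<open>Partial niceness\<close>

lemma dp_colorable_four:
  assumes sg: "simple_graph G" and sub: "subcubic G" and fc: "fold_cover 4 G L H"
  shows "\<exists>I. cover_coloring G H I"
proof -
  interpret graph_cover G L H using sg fc by unfold_locales (auto simp: fold_cover_def)
  obtain c where "transversal (pverts G) c"
    using greedy_transversal[of 3] card_out_nbrs[OF sg sub] fc by (auto simp: fold_cover_def)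
  thus ?thesis using transversal_indep unfolding cover_coloring_def by blast
qed

lemma dp_chromatic_props:
  fixes G :: "'a pair_pre_digraph"
  assumes "simple_graph G" "subcubic G"
  shows "1 \<le> dp_chromatic G" "dp_chromatic G \<le> 4"
    and "\<And>(L :: 'a \<Rightarrow> nat set) H. fold_cover (dp_chromatic G) G L H \<Longrightarrow> \<exists>I. cover_coloring G H I"
proof -
  let ?P = "\<lambda>m. m \<ge> 1 \<and> (\<forall>(L :: 'a \<Rightarrow> nat set) H. fold_cover m G L H \<longrightarrow> (\<exists>I. cover_coloring G H I))"
  have four: "?P 4" using dp_colorable_four[OF assms] by auto
  show "dp_chromatic G \<le> 4" unfolding dp_chromatic_def using four by (rule Least_le)
  have "?P (dp_chromatic G)" unfolding dp_chromatic_def using four by (rule LeastI)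
  thus "1 \<le> dp_chromatic G"
    and "\<And>(L :: 'a \<Rightarrow> nat set) H. fold_cover (dp_chromatic G) G L H \<Longrightarrow> \<exists>I. cover_coloring G H I"
    by blast+
qed

theorem theorem3:
  fixes G :: "'a pair_pre_digraph"
  assumes "simple_graph G"
    and "Digraph_Component.connected (with_proj G)"
    and "subcubic G"
    and "triangle_free G"
    and "\<not> digraph_iso (with_proj G) (with_proj cube_graph)"
  shows "partially_dp_nice G"
  unfolding partially_dp_nice_def
proof
  fix t assume "t \<in> {1..dp_chromatic G}"
  let ?n = "card (pverts G)" and ?x = "dp_chromatic G"
  note x = dp_chromatic_props[OF assms(1,3)]
  have t: "1 \<le> t" "t \<le> ?x" using \<open>t \<in> _\<close> by auto
  have "t * ?n \<le> ?x * partial_dp t G"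
  proof (rule partial_dp_ge[OF assms(1) t(1)])
    fix L :: "'a \<Rightarrow> nat set" and H
    assume fc: "fold_cover t G L H"
    then interpret graph_cover G L H using assms(1) by unfold_locales (auto simp: fold_cover_def)
    have cL: "card (L u) = t" if "u \<in> pverts G" for u using fc that by (simp add: fold_cover_def)
    have bound: "?n - card D \<le> indep_num H" if "D \<subseteq> pverts G" "transversal (pverts G - D) c" for D c
      using transversal_indep_num[OF that(2)] that(1) simple_graphD(1)[OF sg]
      by (simp add: card_Diff_subset finite_subset)
    consider "t = ?x" | "t = 1" | "t = 2" | "t = 3" "?x = 4" using t x(2) by linarith
    thus "t * ?n \<le> ?x * indep_num H"
    proof cases
      case 1
      then obtain I where "cover_coloring G H I" using x(3) fc by metis
      hence "?n \<le> indep_num H" using indep_num_ge[OF sgH] unfolding cover_coloring_def by metis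
      thus ?thesis using 1 by simp
    next
      case 2
      have "fold_cover ?x G (\<lambda>u. L u \<times> {..<?x}) (blow_up ?x H)"
        using fold_cover_blow_up[OF sg _ x(1)] fc 2 by simp
      from fold_cover_transfer_nat[OF this sg] obtain I where "cover_coloring G (blow_up ?x H) I"
        using x(3) by blast
      thus ?thesis using indep_num_blow_up[OF sgH, of ?x I] 2 unfolding cover_coloring_def by simp
    next
      case 3
      show ?thesis
      proof (cases "?x = 2")
        case True
        then obtain I where "cover_coloring G H I" using x(3) fc 3 by metis
        hence "?n \<le> indep_num H" using indep_num_ge[OF sgH] unfolding cover_coloring_def by metis
        thus ?thesis using True 3 by simp
      next
        case False
        have "cube_free (\<lambda>u v. (u, v) \<in> parcs G) (pverts G)"
          using cube_iso[OF assms(1-3)] assms(5) unfolding cube_free_def by blast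
        then obtain D c where D: "D \<subseteq> pverts G" "3 * card D \<le> ?n" "transversal (pverts G - D) c"
          using two_fold_transversal[OF assms(3,4)] cL 3 by blast
        have "2 * ?n \<le> 3 * indep_num H" using bound[OF D(1,3)] D(2) by linarith
        also have "\<dots> \<le> ?x * indep_num H" using False t 3 by (intro mult_right_mono) auto
        finally show ?thesis using 3 by simp
      qed
    next
      case 4
      obtain D c where D: "D \<subseteq> pverts G" "4 * card D \<le> ?n" "transversal (pverts G - D) c"
        using greedy_three_quarters[OF card_out_nbrs[OF sg assms(3)] _ order_refl] cL 4 by blast
      thus ?thesis using bound[OF D(1,3)] 4 by simp
    qed
  qed
  hence "real t * real ?n \<le> real ?x * real (partial_dp t G)" by (metis of_nat_le_iff of_nat_mult)
  thus "real t * real ?n / real ?x \<le> real (partial_dp t G)"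
    using x(1) by (simp add: divide_le_eq mult.commute)
qed

end
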